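(* Let $n\ge 3$ and $u_0\in S_{n-1}$. Let $f(t),h(t),k(t)$ be the polynomials in $t$ attached to $u_0$ (defined in the context). Then the Gotzmann threshold of $u_0$ in $R_n$ is $$\tau_n(u_0)=f(0)-h(0)-k(0),$$ where $f(0),h(0),k(0)$ denote the values at $t=0$ of these polynomials.
   Context: $K$ is a field, $R_n=K[x_1,\dots,x_n]$ with the standard grading, $\mathbb{N}=\{0,1,2,\dots\}$. $S_n$ is the set of monomials $x_1^{a_1}\cdots x_n^{a_n}$ of $R_n$ and $S_{n,d}\subset S_n$ the set of those of degree $d$; $S_{n-1}\subset S_n$. Order: $S_{n,d}$ is ordered lexicographically with maximum $x_1^d$ and minimum $x_n^d$ (for $u\ne v$ in $S_{n,d}$, $u<v$ iff at the smallest index where the exponents of $u,v$ differ, $v$ has the larger exponent). One writes $u\le v$ only when $\deg u=\deg v$. For $u\in S_{n,d}$, $L_n(u)=\{z\in S_{n,d}: z\ge u\}$. For $u\le v$ in $S_{n,d}$, $L_n^*(v,u)=\{z\in S_{n,d}: v>z\ge u\}$. For a monomial $u\neq 1$, $\lambda(u)=x_k$ with $k$ the largest index such that $x_k\mid u$. For a set $B\subseteq S_{n,d}$ ($d\ge1$), $\mathrm{maxgen}(B)=\prod_{u\in B}\lambda(u)$, and $\mathrm{maxgen}(\emptyset)=1$. For $u\le v$ in $S_{n,d}$, $\mu_n(u,v)=\mathrm{maxgen}(L_n^*(v,u))$ (so $\mu_n(u,u)=1$). For $u\in S_{n,d}$, $B(u)\subseteq S_{n,d}$ is the smallest set of monomials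 containing $u$ and stable under $v\mapsto vx_i/x_j$ whenever $x_j\mid v$ and $i\le j$; $\mathrm{gaps}_n(u)=L_n(u)\setminus B(u)$ and $\mathrm{mg}_n(u)=\mathrm{maxgen}(\mathrm{gaps}_n(u))$. $\pi_{n-1}:S_n\to S_{n-1}$ is $\pi_{n-1}(x_1^{a_1}\cdots x_n^{a_n})=x_1^{a_1}\cdots x_{n-1}^{a_{n-1}}$. Gotzmann monomials: $\langle u\rangle\subseteq R_n$ is the ideal generated by $B(u)$, the smallest Borel-stable (strongly stable) monomial ideal of $R_n$ containing $u$. An ideal $I$ generated by monomials of a single degree $d$ is a Gotzmann ideal if its Hilbert function attains Macaulay's lower bound from degree $d$ on, i.e. for all $j\ge d$, $\dim_K I_{j+1}=|\{x_iv: v\in L,\,1\le i\le n\}|$, where $L$ is the set of the $\dim_K I_j$ lexicographically largest monomials of $S_{n,j}$ (by Gotzmann's persistence theorem it suffices to require this for $j=d$). $u\in S_n$ is a Gotzmann monomial in $R_n$ if $\langle u\rangle\subseteq R_n$ is a Gotzmann ideal. By a theorem of Gotzmann, for every $u\in S_n$ there is a unique integer $\tau_n(u)\ge0$, the Gotzmann threshold of $u$ in $R_n$, such that for $s\in\mathbb{N}$, $ux_n^s$ is a Gotzmann monomial in $R_n$ if and only if $s\ge\tau_n(u)$. In particular $\tau_{n-1}(u_0)$ is defined using $R_{n-1}$ and the monomials $u_0x_{n-1}^s$. Polynomials attached to $u_0\in S_{n-1}$, $n\ge3$: for $t\in\mathbb{N}$, $w(t)=\pi_{n-1}(\mathrm{mg}_n(u_0x_n^t))$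 and $f(t)=\deg_{x_n}\mathrm{mg}_n(u_0x_n^t)$. For $t\ge\tau_{n-1}(u_0)$ there exists a smallest monomial $z_n(t)\in S_n$ such that $z_n(t)\ge u_0x_n^t$ and $\pi_{n-1}(\mu_n(u_0x_n^t,z_n(t)))=w(t)$; set $h(t)=\deg_{x_n}\mu_n(u_0x_n^t,z_n(t))$ and $k(t)=\deg_{x_n}z_n(t)$. The function $f$ agrees with a polynomial in $t$ for all $t\in\mathbb{N}$, and $h,k$ agree with polynomials in $t$ for all $t\ge\tau_{n-1}(u_0)$; the same symbols $f(t),h(t),k(t)$ denote these polynomials. *)

theory Defs
  imports
    Complex_Main
    "HOL-Library.Poly_Mapping"
    "HOL-Computational_Algebra.Polynomial"
    "HOL-Algebra.Ideal"
begin

section \<open>Monomials\<close>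

text \<open>
  A monomial \<open>x\<^sub>1^a\<^sub>1 \<cdots> x\<^sub>n^a\<^sub>n\<close> is represented by its exponent vector, a finitely supported
  function on \<^typ>\<open>nat\<close> with support in \<open>{1..n}\<close>. Multiplication of monomials is therefore
  \<^term>\<open>(+)\<close>, the monomial \<open>1\<close> is \<^term>\<open>0\<close>, and \<open>x\<^sub>i^s\<close> is \<^term>\<open>Poly_Mapping.single i s\<close>.
  With this representation \<open>S\<^sub>n\<^sub>-\<^sub>1 \<subseteq> S\<^sub>n\<close> holds literally.

  On exponent vectors the library order \<^term>\<open>(<)\<close> of \<open>Poly_Mapping\<close> is exactly the lexicographic
  order of the text: \<open>u < v\<close> iff at the smallest index where they differ, \<open>v\<close> has the larger
  exponent. All uses below compare monomials of the same degree only.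
\<close>

type_synonym mon = "nat \<Rightarrow>\<^sub>0 nat"

definition mdeg :: "mon \<Rightarrow> nat" where
  "mdeg u = (\<Sum>i\<in>Poly_Mapping.keys u. Poly_Mapping.lookup u i)"

definition mons :: "nat \<Rightarrow> mon set" where
  "mons n = {u. Poly_Mapping.keys u \<subseteq> {1..n}}"

definition mons_deg :: "nat \<Rightarrow> nat \<Rightarrow> mon set" where
  "mons_deg n d = {u \<in> mons n. mdeg u = d}"

lemma mon_less_iff:
  fixes u v :: mon
  shows "u < v \<longleftrightarrow> (\<exists>k. Poly_Mapping.lookup u k < Poly_Mapping.lookup v k \<and>
                     (\<forall>i<k. Poly_Mapping.lookup u i = Poly_Mapping.lookup v i))"
  by transfer (simp add: less_fun_def)

text \<open>\<open>L\<^sub>n(u)\<close> and \<open>L\<^sub>n\<^sup>*(v,u)\<close>\<close>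

definition lex_ge :: "nat \<Rightarrow> mon \<Rightarrow> mon set" where
  "lex_ge n u = {z \<in> mons_deg n (mdeg u). z \<ge> u}"

definition lex_between :: "nat \<Rightarrow> mon \<Rightarrow> mon \<Rightarrow> mon set" where
  "lex_between n v u = {z \<in> mons_deg n (mdeg u). v > z \<and> z \<ge> u}"

text \<open>
  \<open>\<lambda>(u) = x\<^sub>k\<close> with \<open>k\<close> the largest index of a variable dividing \<open>u\<close>. Only used for \<open>u \<noteq> 1\<close>.
\<close>

definition last_var :: "mon \<Rightarrow> mon" where
  "last_var u = Poly_Mapping.single (Max (Poly_Mapping.keys u)) 1"

text \<open>The sum of exponent vectors is the product of monomials.\<close>

definition maxgen :: "mon set \<Rightarrow> mon" where
  "maxgen B = (\<Sum>u\<in>B. last_var u)"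

definition mu :: "nat \<Rightarrow> mon \<Rightarrow> mon \<Rightarrow> mon" where
  "mu n u v = maxgen (lex_between n v u)"

text \<open>
  \<open>B(u)\<close>. The exchange steps never increase an index, so the set does not depend on \<open>n\<close>.
\<close>

inductive_set borel_set :: "mon \<Rightarrow> mon set" for u :: mon where
  base: "u \<in> borel_set u"
| step: "v \<in> borel_set u \<Longrightarrow> j \<in> Poly_Mapping.keys v \<Longrightarrow> 1 \<le> i \<Longrightarrow> i \<le> j \<Longrightarrow>
         v + Poly_Mapping.single i 1 - Poly_Mapping.single j 1 \<in> borel_set u"

definition gaps :: "nat \<Rightarrow> mon \<Rightarrow> mon set" where
  "gaps n u = lex_ge n u - borel_set u"

definition mg :: "nat \<Rightarrow> mon \<Rightarrow> mon" where
  "mg n u = maxgen (gaps n u)"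

text \<open>\<open>\<pi>\<^sub>m\<close>, keeping the exponents of \<open>x\<^sub>1, \<dots>, x\<^sub>m\<close> only\<close>

definition proj :: "nat \<Rightarrow> mon \<Rightarrow> mon" where
  "proj m u = (\<Sum>i\<in>{1..m}. Poly_Mapping.single i (Poly_Mapping.lookup u i))"

section \<open>Gotzmann ideals and Gotzmann monomials\<close>

text \<open>
  \<open>R\<^sub>n\<close> is the subring of the monoid algebra \<open>K[\<nat>\<^sup>(\<^sup>\<nat>\<^sup>)]\<close> of those polynomials in which only
  monomials of \<open>S\<^sub>n\<close> occur.
\<close>

type_synonym 'k mpol = "mon \<Rightarrow>\<^sub>0 'k"

definition poly_ring :: "nat \<Rightarrow> ('k::field) mpol ring" where
  "poly_ring n = \<lparr>carrier = {p. Poly_Mapping.keys p \<subseteq> mons n}, mult = (*), one = 1,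
                  zero = 0, add = (+)\<rparr>"

lemma mons_0: "0 \<in> mons n"
  by (simp add: mons_def)

lemma mons_add: "u \<in> mons n \<Longrightarrow> v \<in> mons n \<Longrightarrow> u + v \<in> mons n"
  using Poly_Mapping.keys_add[of u v] by (auto simp: mons_def)

lemma cring_poly_ring: "cring (poly_ring n :: ('k::field) mpol ring)"
proof (rule cringI)
  show "abelian_group (poly_ring n :: 'k mpol ring)"
  proof (rule abelian_groupI)
    fix p q :: "'k mpol"
    assume "p \<in> carrier (poly_ring n)" "q \<in> carrier (poly_ring n)"
    then show "p \<oplus>\<^bsub>poly_ring n\<^esub> q \<in> carrier (poly_ring n)"
      using Poly_Mapping.keys_add[of p q] by (auto simp: poly_ring_def)
  next
    fix p :: "'k mpol"
    assume "p \<in> carrier (poly_ring n)"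
    then show "\<exists>q\<in>carrier (poly_ring n). q \<oplus>\<^bsub>poly_ring n\<^esub> p = \<zero>\<^bsub>poly_ring n\<^esub>"
      by (intro bexI[of _ "- p"]) (auto simp: poly_ring_def in_keys_iff subset_iff)
  qed (auto simp: poly_ring_def algebra_simps)
  show "comm_monoid (poly_ring n :: 'k mpol ring)"
  proof (rule comm_monoidI)
    fix p q :: "'k mpol"
    assume "p \<in> carrier (poly_ring n)" "q \<in> carrier (poly_ring n)"
    then show "p \<otimes>\<^bsub>poly_ring n\<^esub> q \<in> carrier (poly_ring n)"
      using Poly_Mapping.keys_mult[of p q] mons_add by (fastforce simp: poly_ring_def)
  qed (auto simp: poly_ring_def algebra_simps mons_0)
qed (auto simp: poly_ring_def algebra_simps)

definition scale :: "'k::field \<Rightarrow> 'k mpol \<Rightarrow> 'k mpol" where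
  "scale c p = Poly_Mapping.single 0 c * p"

lemma vector_space_scale: "vector_space (scale :: 'k::field \<Rightarrow> _)"
  by unfold_locales
    (simp_all add: scale_def algebra_simps single_add mult_single flip: mult.assoc single_one)

definition mon_ideal :: "nat \<Rightarrow> mon set \<Rightarrow> ('k::field) mpol set" where
  "mon_ideal n B = Idl\<^bsub>poly_ring n\<^esub> ((\<lambda>v. Poly_Mapping.single v 1) ` B)"

text \<open>\<open>dim\<^sub>K I\<^sub>j\<close>\<close>

definition hilb :: "('k::field) mpol set \<Rightarrow> nat \<Rightarrow> nat" where
  "hilb I j = vector_space.dim scale {p \<in> I. \<forall>v\<in>Poly_Mapping.keys p. mdeg v = j}"

text \<open>The \<open>m\<close> lexicographically largest monomials of \<open>S\<^sub>n\<^sub>,\<^sub>j\<close>\<close>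

definition lex_largest :: "nat \<Rightarrow> nat \<Rightarrow> nat \<Rightarrow> mon set" where
  "lex_largest n j m = {v \<in> mons_deg n j. card {z \<in> mons_deg n j. z > v} < m}"

definition gotzmann_ideal :: "nat \<Rightarrow> ('k::field) mpol set \<Rightarrow> bool" where
  "gotzmann_ideal n I \<longleftrightarrow>
     (\<exists>d G. G \<subseteq> mons_deg n d \<and> I = mon_ideal n G \<and>
        (\<forall>j\<ge>d. hilb I (j + 1) =
           card {v + Poly_Mapping.single i 1 | v i. v \<in> lex_largest n j (hilb I j) \<and> i \<in> {1..n}}))"

text \<open>The type argument is the coefficient field \<open>K\<close>.\<close>

definition gotzmann_monomial :: "'k::field itself \<Rightarrow> nat \<Rightarrow> mon \<Rightarrow> bool" where
  "gotzmann_monomial K n u \<longleftrightarrow> gotzmann_ideal n (mon_ideal n (borel_set u) :: 'k mpol set)"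

definition gotzmann_threshold :: "'k::field itself \<Rightarrow> nat \<Rightarrow> mon \<Rightarrow> nat" where
  "gotzmann_threshold K n u =
     (THE \<tau>. \<forall>s. gotzmann_monomial K n (u + Poly_Mapping.single n s) \<longleftrightarrow> s \<ge> \<tau>)"

section \<open>The polynomials attached to a monomial\<close>

definition w_mon :: "nat \<Rightarrow> mon \<Rightarrow> nat \<Rightarrow> mon" where
  "w_mon n u0 t = proj (n - 1) (mg n (u0 + Poly_Mapping.single n t))"

definition f_val :: "nat \<Rightarrow> mon \<Rightarrow> nat \<Rightarrow> nat" where
  "f_val n u0 t = Poly_Mapping.lookup (mg n (u0 + Poly_Mapping.single n t)) n"

text \<open>\<open>z\<^sub>n(t)\<close>; \<^term>\<open>lex_ge\<close> contains only monomials of the same degree.\<close>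

definition z_mon :: "nat \<Rightarrow> mon \<Rightarrow> nat \<Rightarrow> mon" where
  "z_mon n u0 t = (LEAST z. z \<in> lex_ge n (u0 + Poly_Mapping.single n t) \<and>
                      proj (n - 1) (mu n (u0 + Poly_Mapping.single n t) z) = w_mon n u0 t)"

definition h_val :: "nat \<Rightarrow> mon \<Rightarrow> nat \<Rightarrow> nat" where
  "h_val n u0 t =
     Poly_Mapping.lookup (mu n (u0 + Poly_Mapping.single n t) (z_mon n u0 t)) n"

definition k_val :: "nat \<Rightarrow> mon \<Rightarrow> nat \<Rightarrow> nat" where
  "k_val n u0 t = Poly_Mapping.lookup (z_mon n u0 t) n"

text \<open>The polynomial that agrees with \<open>g\<close> at all integers \<open>t \<ge> s\<close>\<close>

definition poly_from :: "nat \<Rightarrow> (nat \<Rightarrow> nat) \<Rightarrow> rat poly" where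
  "poly_from s g = (THE p. \<forall>t\<ge>s. poly p (of_nat t) = of_nat (g t))"

lemma poly_from_eqI:
  assumes "\<And>t. t \<ge> s \<Longrightarrow> poly p (of_nat t) = of_nat (g t)"
  shows "poly_from s g = p"
  unfolding poly_from_def
proof (rule the_equality)
  show "\<forall>t\<ge>s. poly p (of_nat t) = of_nat (g t)" using assms by blast
next
  fix q :: "rat poly"
  assume q: "\<forall>t\<ge>s. poly q (of_nat t) = of_nat (g t)"
  have "infinite ((of_nat :: nat \<Rightarrow> rat) ` {s..})"
    by (simp add: finite_image_iff inj_on_def infinite_Ici)
  moreover have "(of_nat :: nat \<Rightarrow> rat) ` {s..} \<subseteq> {x. poly (q - p) x = 0}"
    using q assms by auto
  ultimately have "infinite {x. poly (q - p) x = 0}"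
    using finite_subset by blast
  then have "q - p = 0" using poly_roots_finite by blast
  then show "q = p" by simp
qed

definition f_poly :: "nat \<Rightarrow> mon \<Rightarrow> rat poly" where
  "f_poly n u0 = poly_from 0 (f_val n u0)"

definition h_poly :: "'k::field itself \<Rightarrow> nat \<Rightarrow> mon \<Rightarrow> rat poly" where
  "h_poly K n u0 = poly_from (gotzmann_threshold K (n - 1) u0) (h_val n u0)"

definition k_poly :: "'k::field itself \<Rightarrow> nat \<Rightarrow> mon \<Rightarrow> rat poly" where
  "k_poly K n u0 = poly_from (gotzmann_threshold K (n - 1) u0) (k_val n u0)"

end

theory Submission
  imports Defs
begin

text \<open>
  Let \<open>B(u)\<close> be compared with lexicographic segments through the numbers of monomials involving only
  \<open>x\<^sub>1, \<dots>, x\<^sub>m\<close>, for all \<open>m\<close>. Multiplying a stable set by the variables replaces these numbers by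
  their partial sums, so by Macaulay's inequality \<open>u\<close> is Gotzmann in \<open>R\<^sub>n\<close> iff they agree with those of
  a segment \<open>L\<^sub>n(v)\<close>. For \<open>u = u\<^sub>0x\<^sub>n^t\<close> the numbers with \<open>m < n\<close> are those of \<open>u\<^sub>0x\<^sub>n\<^sub>-\<^sub>1^t\<close> in \<open>R\<^sub>n\<^sub>-\<^sub>1\<close>; if
  this monomial is Gotzmann, matched by \<open>L\<^sub>n\<^sub>-\<^sub>1(z)\<close>, the candidates \<open>v\<close> form the interval from \<open>z\<^sub>n(t)\<close> to
  \<open>z\<close>, which has \<open>k(t)\<close> steps. Hence \<open>u\<close> is Gotzmann iff \<open>f(t) - h(t) \<le> k(t)\<close>. Passing from \<open>t\<close> to
  \<open>t + 1\<close> multiplies \<open>z\<^sub>n(t)\<close> by \<open>x\<^sub>n\<close>, so \<open>f - h\<close> is constant and \<open>k\<close> is linear with slope one, and the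
  inequality reads \<open>f(0) - h(0) - k(0) \<le> t\<close>. Finally this bound is at least \<open>s = \<tau>\<^sub>n\<^sub>-\<^sub>1(u\<^sub>0)\<close>, because
  for \<open>s > 0\<close> minimality of \<open>s\<close> forces \<open>x\<^sub>n\<^sub>-\<^sub>1\<close> not to divide \<open>z\<close> at \<open>t = s\<close>, that is \<open>k(s) = 0\<close>.
\<close>

declare One_nat_def [simp del]

abbreviation expo :: "mon \<Rightarrow> nat \<Rightarrow> nat" where
  "expo \<equiv> Poly_Mapping.lookup"

abbreviation xpow :: "nat \<Rightarrow> nat \<Rightarrow> mon" where
  "xpow \<equiv> Poly_Mapping.single"

abbreviation xvar :: "nat \<Rightarrow> mon" where
  "xvar i \<equiv> xpow i 1"

text \<open>Comparing these partial degrees for all \<open>i\<close> gives the dominance order,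
  which describes principal Borel sets in \<open>borel_set_iff\<close>.\<close>

definition msum :: "mon \<Rightarrow> nat \<Rightarrow> nat" where
  "msum u i = (\<Sum>j\<le>i. expo u j)"

section \<open>Monomials and partial degrees\<close>

lemma expo_xpow: "expo (xpow i a) j = (if j = i then a else 0)"
  by (auto simp: lookup_single when_def)

lemma msum_add: "msum (u + v) i = msum u i + msum v i"
  by (simp add: msum_def lookup_add sum.distrib)

lemma msum_xpow: "msum (xpow i a) j = (if i \<le> j then a else 0)"
  by (simp add: msum_def expo_xpow)

lemma msum_Suc: "msum u (Suc i) = msum u i + expo u (Suc i)"
  by (simp add: msum_def)

lemma msum_mono: "i \<le> j \<Longrightarrow> msum u i \<le> msum u j"
  unfolding msum_def by (rule sum_mono2) auto

lemma msum_diff: "0 < i \<Longrightarrow> msum u i = msum u (i - 1) + expo u i"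
  by (cases i) (auto simp: msum_Suc)

lemma mons_iff: "u \<in> mons n \<longleftrightarrow> expo u 0 = 0 \<and> (\<forall>i>n. expo u i = 0)"
proof
  assume "u \<in> mons n"
  then have "i \<in> {1..n}" if "expo u i \<noteq> 0" for i
    using that unfolding mons_def in_keys_iff[symmetric] by blast
  then show "expo u 0 = 0 \<and> (\<forall>i>n. expo u i = 0)"
    by (metis atLeastAtMost_iff not_less not_one_le_zero)
next
  assume a: "expo u 0 = 0 \<and> (\<forall>i>n. expo u i = 0)"
  show "u \<in> mons n"
    unfolding mons_def
  proof (intro CollectI subsetI)
    fix i assume "i \<in> Poly_Mapping.keys u"
    with a have "i \<noteq> 0" "\<not> n < i" by (metis in_keys_iff)+
    then show "i \<in> {1..n}" by simp
  qed
qed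

lemma mons_mono: "m \<le> n \<Longrightarrow> mons m \<subseteq> mons n"
  by (auto simp: mons_iff)

lemma mons_add_iff: "u + v \<in> mons n \<longleftrightarrow> u \<in> mons n \<and> v \<in> mons n"
  by (auto simp: mons_iff lookup_add)

lemma xpow_in_mons: "1 \<le> i \<Longrightarrow> i \<le> n \<Longrightarrow> xpow i a \<in> mons n"
  by (simp add: mons_def)

lemma xvar_in_mons_iff: "xvar i \<in> mons n \<longleftrightarrow> 1 \<le> i \<and> i \<le> n"
  by (simp add: mons_def)

lemma mons_0_eq: "mons 0 = {0}"
  by (auto simp: mons_def)

lemma msum_mdeg:
  assumes "u \<in> mons n" "n \<le> i"
  shows "msum u i = mdeg u"
  unfolding msum_def mdeg_def using assms
  by (intro sum.mono_neutral_right) (auto simp: mons_def in_keys_iff)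

lemma mdeg_xpow: "mdeg (xpow i a) = a"
  by (auto simp: mdeg_def)

lemma mdeg_add: "mdeg (u + v) = mdeg u + mdeg v"
proof -
  have "mdeg w = (\<Sum>i\<in>Poly_Mapping.keys u \<union> Poly_Mapping.keys v. expo w i)"
    if "Poly_Mapping.keys w \<subseteq> Poly_Mapping.keys u \<union> Poly_Mapping.keys v" for w :: mon
    unfolding mdeg_def using that by (intro sum.mono_neutral_left) (auto simp: in_keys_iff)
  from this[of u] this[of v] this[of "u + v"] keys_add[of u v] show ?thesis
    by (simp add: lookup_add sum.distrib)
qed

lemma mdeg_eq_0_iff: "mdeg u = 0 \<longleftrightarrow> u = 0"
  by (auto simp: mdeg_def in_keys_iff intro!: poly_mapping_eqI)

lemma expo_le_mdeg: "expo u i \<le> mdeg u"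
  unfolding mdeg_def
  by (cases "i \<in> Poly_Mapping.keys u") (auto intro: member_le_sum simp: in_keys_iff)

lemma msum_less_first: "msum u 0 = expo u 0"
  by (simp add: msum_def)

lemma msum_eqI:
  assumes "\<And>i. msum u i = msum v i"
  shows "u = v"
proof (rule poly_mapping_eqI)
  fix k show "expo u k = expo v k"
    using assms[of k] assms[of "k - 1"] msum_diff[of k u] msum_diff[of k v]
    by (cases "k = 0") (auto simp: msum_less_first)
qed

lemma msum_cong: "(\<And>j. j \<le> i \<Longrightarrow> expo u j = expo v j) \<Longrightarrow> msum u i = msum v i"
  by (auto simp: msum_def)

text \<open>The degree determines the exponent of x_n once the earlier exponents are known.\<close>

lemma mons_deg_eqI:
  assumes "u \<in> mons n" "v \<in> mons n" "mdeg u = mdeg v" "\<And>i. i < n \<Longrightarrow> expo u i = expo v i"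
  shows "u = v"
proof (rule msum_eqI)
  fix i show "msum u i = msum v i"
    by (cases "i < n") (use assms msum_mdeg in \<open>auto intro: msum_cong\<close>)
qed

lemma finite_mons_deg: "finite (mons_deg n d)"
proof (rule finite_subset)
  show "mons_deg n d \<subseteq> (\<lambda>f. Abs_poly_mapping (\<lambda>i. if i \<in> {..n} then f i else 0)) ` ({..n} \<rightarrow>\<^sub>E {..d})"
  proof
    fix u assume u: "u \<in> mons_deg n d"
    have "u = Abs_poly_mapping (\<lambda>i. if i \<in> {..n} then restrict (expo u) {..n} i else 0)"
    proof (rule poly_mapping_eqI)
      fix k
      have "(\<lambda>i. if i \<in> {..n} then restrict (expo u) {..n} i else 0) = expo u"
        using u by (auto simp: mons_deg_def mons_iff)
      then show "expo u k = expo (Abs_poly_mapping (\<lambda>i. if i \<in> {..n} then restrict (expo u) {..n} i else 0)) k"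
        by (simp add: lookup_inverse)
    qed
    moreover have "restrict (expo u) {..n} \<in> {..n} \<rightarrow>\<^sub>E {..d}"
      using u expo_le_mdeg[of u] by (auto simp: mons_deg_def)
    ultimately show "u \<in> (\<lambda>f. Abs_poly_mapping (\<lambda>i. if i \<in> {..n} then f i else 0)) ` ({..n} \<rightarrow>\<^sub>E {..d})"
      by blast
  qed
qed (simp add: finite_PiE)

section \<open>Splitting off powers of a variable\<close>

lemma mons_split_last:
  assumes "v \<in> mons (Suc n)" "v \<notin> mons n"
  obtains w where "w \<in> mons (Suc n)" "v = w + xvar (Suc n)"
proof
  have pos: "0 < expo v (Suc n)"
  proof (rule ccontr)
    assume "\<not> 0 < expo v (Suc n)"
    then have "expo v i = 0" if "n < i" for i
      using assms(1) that by (cases "i = Suc n") (auto simp: mons_iff)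
    then show False using assms by (auto simp: mons_iff)
  qed
  then show eq: "v = (v - xvar (Suc n)) + xvar (Suc n)"
    by (intro poly_mapping_eqI) (auto simp: lookup_add lookup_minus expo_xpow)
  then show "v - xvar (Suc n) \<in> mons (Suc n)"
    using assms(1) mons_add_iff by metis
qed

lemma expo_pos_split:
  assumes "0 < expo v i"
  obtains w where "v = w + xvar i"
proof
  show "v = (v - xvar i) + xvar i"
    using assms by (intro poly_mapping_eqI) (auto simp: lookup_add lookup_minus expo_xpow)
qed

lemma expo_ge_split:
  assumes "a \<le> expo v i"
  obtains w where "v = w + xpow i a" "expo w i = expo v i - a"
proof
  show "v = (v - xpow i a) + xpow i a"
    using assms by (intro poly_mapping_eqI) (auto simp: lookup_add lookup_minus expo_xpow)
qed (simp add: lookup_minus)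

section \<open>Stable sets and growth\<close>

text \<open>Both monomials are multiples of a common \<open>v\<close>, which avoids truncated
  subtraction of exponents.\<close>

definition borel_stable :: "mon set \<Rightarrow> bool" where
  "borel_stable A \<longleftrightarrow> (\<forall>v i j. v + xvar j \<in> A \<longrightarrow> 1 \<le> i \<longrightarrow> i \<le> j \<longrightarrow> v + xvar i \<in> A)"

definition mulvars :: "nat \<Rightarrow> mon set \<Rightarrow> mon set" where
  "mulvars n A = {v + xvar i | v i. v \<in> A \<and> i \<in> {1..n}}"

lemma stableD: "borel_stable A \<Longrightarrow> v + xvar j \<in> A \<Longrightarrow> 1 \<le> i \<Longrightarrow> i \<le> j \<Longrightarrow> v + xvar i \<in> A"
  by (auto simp: borel_stable_def)

lemma stable_Int_mons: "borel_stable A \<Longrightarrow> borel_stable (A \<inter> mons m)"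
  unfolding borel_stable_def by (auto simp: mons_add_iff xvar_in_mons_iff)

lemma stableD_pow:
  assumes "borel_stable A" "1 \<le> i" "i \<le> k"
  shows "v + xpow k j \<in> A \<Longrightarrow> v + xpow i j \<in> A"
proof (induction j arbitrary: v)
  case (Suc j)
  have split: "xpow l (Suc j) = xpow l j + xvar l" for l
    by (simp flip: single_add Suc_eq_plus1)
  have "(v + xpow k j) + xvar k \<in> A"
    using Suc.prems by (simp add: split add.assoc)
  then have "(v + xvar i) + xpow k j \<in> A"
    using stableD[OF assms(1) _ assms(2,3)] by (metis add.assoc add.commute)
  then have "(v + xvar i) + xpow i j \<in> A"
    by (rule Suc.IH)
  then show ?case by (simp add: split ac_simps)
qed simp

lemma mulvars_subset: "A \<subseteq> mons_deg n d \<Longrightarrow> mulvars n A \<subseteq> mons_deg n (Suc d)"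
  by (auto simp: mulvars_def mons_deg_def mons_add_iff xvar_in_mons_iff mdeg_add mdeg_xpow
     )

text \<open>By stability, a product that involves x_{m+1} but no later variable is x_{m+1} times a
  member of \<open>A\<close>; these products give the second summand.\<close>

lemma card_mulvars_step:
  assumes st: "borel_stable A" and sub: "A \<subseteq> mons_deg n d" and m: "Suc m \<le> n"
  shows "card (mulvars n A \<inter> mons (Suc m)) = card (mulvars n A \<inter> mons m) + card (A \<inter> mons (Suc m))"
proof -
  have eq: "mulvars n A \<inter> mons (Suc m) =
      (mulvars n A \<inter> mons m) \<union> (\<lambda>v. v + xvar (Suc m)) ` (A \<inter> mons (Suc m))" (is "?L = ?R")
  proof
    show "?R \<subseteq> ?L"
    proof
      fix y assume "y \<in> ?R"
      then show "y \<in> ?L"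
      proof
        assume "y \<in> mulvars n A \<inter> mons m"
        then show ?thesis using mons_mono[of m "Suc m"] by auto
      next
        assume "y \<in> (\<lambda>v. v + xvar (Suc m)) ` (A \<inter> mons (Suc m))"
        then obtain v where "v \<in> A" "v \<in> mons (Suc m)" "y = v + xvar (Suc m)" by auto
        moreover have "Suc m \<in> {1..n}" using m by auto
        ultimately show ?thesis
          unfolding mulvars_def using mons_add_iff xvar_in_mons_iff by fastforce
      qed
    qed
    show "?L \<subseteq> ?R"
    proof
      fix y assume y: "y \<in> ?L"
      then obtain v i where v: "v \<in> A" "1 \<le> i" "i \<le> n" and yv: "y = v + xvar i"
        by (auto simp: mulvars_def)
      have im: "i \<le> Suc m" and vm: "v \<in> mons (Suc m)"
        using y yv by (auto simp: mons_add_iff xvar_in_mons_iff)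
      show "y \<in> ?R"
      proof (cases "y \<in> mons m")
        case True then show ?thesis using y by simp
      next
        case False
        then obtain w where w: "w \<in> mons (Suc m)" "y = w + xvar (Suc m)"
          using mons_split_last[of y m] y by auto
        \<comment> \<open>If x_i is not x_{m+1}, then x_{m+1} divides \<open>v\<close>, and
          exchanging it for x_i turns \<open>v\<close> into \<open>w\<close>.\<close>
        have "w \<in> A"
        proof (cases "i = Suc m")
          case True then show ?thesis using w yv v by simp
        next
          case False
          then have "0 < expo v (Suc m)"
            using arg_cong[OF yv, of "\<lambda>y. expo y (Suc m)"] w
            by (simp add: lookup_add expo_xpow)
          then obtain v' where v': "v = v' + xvar (Suc m)" by (rule expo_pos_split)
          then have "w + xvar (Suc m) = (v' + xvar i) + xvar (Suc m)"
            using w yv by (simp add: ac_simps)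
          then have "w = v' + xvar i" by simp
          then show ?thesis using stableD[OF st, of v' "Suc m" i] v v' im by simp
        qed
        then show ?thesis using w by blast
      qed
    qed
  qed
  have fin: "finite A" using finite_subset[OF sub finite_mons_deg] .
  have fin2: "finite (mulvars n A)" using finite_subset[OF mulvars_subset[OF sub] finite_mons_deg] .
  have "(mulvars n A \<inter> mons m) \<inter> (\<lambda>v. v + xvar (Suc m)) ` (A \<inter> mons (Suc m)) = {}"
    by (auto simp: mons_add_iff xvar_in_mons_iff)
  then have "card (mulvars n A \<inter> mons (Suc m)) = card (mulvars n A \<inter> mons m)
      + card ((\<lambda>v. v + xvar (Suc m)) ` (A \<inter> mons (Suc m)))"
    unfolding eq using fin fin2 by (intro card_Un_disjoint) auto
  also have "card ((\<lambda>v. v + xvar (Suc m)) ` (A \<inter> mons (Suc m))) = card (A \<inter> mons (Suc m))"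
    by (intro card_image) (auto simp: inj_on_def)
  finally show ?thesis .
qed

lemma mons_deg_Int_mons_0: "A \<subseteq> mons_deg n (Suc d) \<Longrightarrow> A \<inter> mons 0 = {}"
  using mdeg_eq_0_iff[of 0] by (auto simp: mons_0_eq mons_deg_def)

text \<open>Iterates \<open>card_mulvars_step\<close>; the count at \<open>m = 0\<close> vanishes
  because products have positive degree.\<close>

lemma card_mulvars_sum:
  assumes "borel_stable A" "A \<subseteq> mons_deg n d" "m \<le> n"
  shows "card (mulvars n A \<inter> mons m) = (\<Sum>i\<in>{1..m}. card (A \<inter> mons i))"
  using assms(3)
proof (induction m)
  case 0
  then show ?case using mons_deg_Int_mons_0[OF mulvars_subset[OF assms(2)]] by simp
next
  case (Suc m)
  then show ?case using card_mulvars_step[OF assms(1,2), of m] by simp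
qed

lemma Int_mons_all: "A \<subseteq> mons_deg n d \<Longrightarrow> A \<inter> mons n = A"
  by (auto simp: mons_deg_def)

section \<open>Principal Borel sets and lexicographic segments\<close>

lemma add_exchange: "v + a + b - a = v + (b :: mon)"
  by (metis add.assoc add.commute add_diff_cancel_right')

lemma borel_set_stable: "borel_stable (borel_set u)"
  unfolding borel_stable_def
proof (intro allI impI)
  fix v i j assume a: "v + xvar j \<in> borel_set u" "1 \<le> i" "i \<le> j"
  have "(v + xvar j) + xvar i - xvar j \<in> borel_set u"
    using a by (intro borel_set.step) (auto simp: in_keys_iff lookup_add expo_xpow)
  then show "v + xvar i \<in> borel_set u" by (simp add: add_exchange)
qed

text \<open>An exchange of x_j for x_i with \<open>i \<le> j\<close> raises the partial degrees at
  the indices from \<open>i\<close> to \<open>j - 1\<close> and keeps the others.\<close>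

lemma borel_set_sound:
  assumes "u \<in> mons n" "v \<in> borel_set u"
  shows "v \<in> mons n \<and> mdeg v = mdeg u \<and> (\<forall>i. msum u i \<le> msum v i)"
  using assms(2)
proof (induction)
  case base
  then show ?case using assms(1) by simp
next
  case (step v j i)
  then have "0 < expo v j" by (simp add: in_keys_iff)
  then obtain w where w: "v = w + xvar j" by (rule expo_pos_split)
  then have eq: "v + xvar i - xvar j = w + xvar i"
    by (simp add: add_exchange)
  have "j \<le> n" "w \<in> mons n"
    using step.IH unfolding w by (auto simp: mons_add_iff xvar_in_mons_iff)
  with step show ?case unfolding eq unfolding w
    by (auto simp: mons_add_iff xvar_in_mons_iff mdeg_add mdeg_xpow msum_add msum_xpow)
      (smt (verit) add.right_neutral le_trans trans_le_add1)+
qed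

text \<open>Induction on the total excess of the partial degrees of \<open>v\<close> over those of
  \<open>u\<close>: a reverse exchange at the first excess brings \<open>v\<close> closer to
  \<open>u\<close>, and stability undoes it.\<close>

lemma borel_set_complete:
  assumes "u \<in> mons n"
  shows "v \<in> mons n \<Longrightarrow> mdeg v = mdeg u \<Longrightarrow> (\<And>i. msum u i \<le> msum v i) \<Longrightarrow> v \<in> borel_set u"
proof (induction "\<Sum>i\<le>n. msum v i - msum u i" arbitrary: v rule: less_induct)
  case less
  show ?case
  proof (cases "v = u")
    case True then show ?thesis by (simp add: borel_set.base)
  next
    case False
    then obtain i0 where "msum v i0 \<noteq> msum u i0" using msum_eqI by blast
    then have ex: "\<exists>i. msum u i < msum v i" using less.prems(3)[of i0] by (metis order_le_neq_trans)
    define i where "i = (LEAST i. msum u i < msum v i)"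
    have i: "msum u i < msum v i" unfolding i_def using ex by (rule LeastI_ex)
    have i_min: "msum u j = msum v j" if "j < i" for j
      using not_less_Least[of j "\<lambda>i. msum u i < msum v i"] that less.prems(3)[of j] by (auto simp: i_def)
    have i0: "i \<noteq> 0"
    proof
      assume "i = 0"
      with i less.prems(1) show False by (auto simp: msum_less_first mons_iff)
    qed
    have iln: "i < n"
      using i msum_mdeg[OF assms, of i] msum_mdeg[OF less.prems(1), of i] less.prems(2)
      by (cases "i < n") auto
    have "0 < expo v i"
      using i i0 i_min[of "i - 1"] msum_diff[of i u] msum_diff[of i v] by auto
    then obtain w where w: "v = w + xvar i" by (rule expo_pos_split)
    \<comment> \<open>Moving one x_i to x_{i+1} lowers only the partial degree at \<open>i\<close>,
      and only by one, so \<open>v'\<close> still dominates \<open>u\<close>.\<close>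
    define v' where "v' = w + xvar (Suc i)"
    have wn: "w \<in> mons n" using less.prems(1) w by (simp add: mons_add_iff)
    have ms: "msum v' j = (if j = i then msum v j - 1 else msum v j)" for j
      by (auto simp: v'_def w msum_add msum_xpow)
    have v'_le: "msum u j \<le> msum v' j" for j using ms less.prems(3)[of j] i by auto
    have "v' \<in> borel_set u"
    proof (rule less.hyps)
      have "(\<Sum>j\<le>n. msum v' j - msum u j) < (\<Sum>j\<le>n. msum v j - msum u j)"
        using iln i by (intro sum_strict_mono_ex1) (auto simp: ms intro!: bexI[of _ i])
      then show "(\<Sum>j\<le>n. msum v' j - msum u j) < (\<Sum>j\<le>n. msum v j - msum u j)" .
      show "v' \<in> mons n" using wn iln by (auto simp: v'_def mons_add_iff xvar_in_mons_iff)
      show "mdeg v' = mdeg u" using less.prems(2) by (simp add: v'_def w mdeg_add mdeg_xpow)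
    qed (rule v'_le)
    then show ?thesis
      using stableD[OF borel_set_stable, of w "Suc i" u i] i0 by (simp add: w v'_def)
  qed
qed

lemma borel_set_iff:
  assumes "u \<in> mons n"
  shows "v \<in> borel_set u \<longleftrightarrow> v \<in> mons n \<and> mdeg v = mdeg u \<and> (\<forall>i. msum u i \<le> msum v i)"
  using borel_set_sound[OF assms] borel_set_complete[OF assms] by blast

lemma borel_set_subset: "u \<in> mons n \<Longrightarrow> borel_set u \<subseteq> mons_deg n (mdeg u)"
  by (auto simp: borel_set_iff mons_deg_def)

lemma lex_ge_subset: "lex_ge n u \<subseteq> mons_deg n (mdeg u)"
  by (auto simp: lex_ge_def)

lemma xvar_mono: "i \<le> j \<Longrightarrow> xvar j \<le> xvar i"
  by (cases "i = j") (auto simp: mon_less_iff expo_xpow intro!: less_imp_le exI[of _ i])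

lemma mon_less_msum:
  assumes "u < v"
  shows "\<exists>i. msum u i < msum v i \<and> (\<forall>j<i. expo u j = expo v j)"
proof -
  obtain k where k: "expo u k < expo v k" "\<And>i. i < k \<Longrightarrow> expo u i = expo v i"
    using assms by (auto simp: mon_less_iff)
  then have "k = 0 \<or> msum u (k - 1) = msum v (k - 1)" by (auto intro: msum_cong)
  then have "msum u k < msum v k"
    using k msum_diff[of k u] msum_diff[of k v] by (cases "k = 0") (auto simp: msum_less_first)
  with k show ?thesis by auto
qed

lemma borel_set_subset_lex_ge: "u \<in> mons n \<Longrightarrow> borel_set u \<subseteq> lex_ge n u"
proof
  fix v assume u: "u \<in> mons n" and "v \<in> borel_set u"
  then have v: "v \<in> mons n" "mdeg v = mdeg u" "\<And>i. msum u i \<le> msum v i"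
    by (auto simp: borel_set_iff)
  have "\<not> v < u" using v(3) mon_less_msum[of v u] by (meson leD)
  then show "v \<in> lex_ge n u" using v by (simp add: lex_ge_def mons_deg_def)
qed

lemma lex_ge_stable: "borel_stable (lex_ge n u)"
  unfolding borel_stable_def
proof (intro allI impI)
  fix v i j assume a: "v + xvar j \<in> lex_ge n u" "1 \<le> i" "i \<le> j"
  then have "v + xvar j \<le> v + xvar i" using xvar_mono by (intro add_left_mono) auto
  then show "v + xvar i \<in> lex_ge n u" using a order_trans[of u "v + xvar j" "v + xvar i"]
    by (auto simp: lex_ge_def mons_deg_def mons_add_iff mdeg_add mdeg_xpow xvar_in_mons_iff)
qed

section \<open>Multiplying Borel sets and lexicographic segments by the variables\<close>

lemma mons_last_var:
  assumes "y \<in> mons n" "y \<noteq> 0"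
  obtains m w where "1 \<le> m" "m \<le> n" "y \<in> mons m" "y = w + xvar m" "w \<in> mons m"
proof -
  define m where "m = (LEAST m. y \<in> mons m)"
  have m: "y \<in> mons m" unfolding m_def using assms(1) by (rule LeastI)
  have mn: "m \<le> n" unfolding m_def using assms(1) by (rule Least_le)
  obtain l where l: "m = Suc l" using m assms(2) mons_0_eq by (cases m) auto
  have "y \<notin> mons l" using not_less_Least[of l "\<lambda>m. y \<in> mons m"] l by (auto simp: m_def)
  then obtain w where "w \<in> mons m" "y = w + xvar m" using mons_split_last m l by metis
  then show ?thesis using that[of m w] m mn l by auto
qed

text \<open>Dividing \<open>y\<close> by its last variable x_m keeps the partial degrees below
  \<open>m\<close>, and from \<open>m\<close> on the quotient has its full degree, so it still
  dominates \<open>u\<close>.\<close>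

lemma mulvars_borel_set:
  assumes u: "u \<in> mons n" and n: "1 \<le> n"
  shows "mulvars n (borel_set u) = borel_set (u + xvar n)"
proof
  have un: "u + xvar n \<in> mons n" using u n by (simp add: mons_add_iff xvar_in_mons_iff)
  show "mulvars n (borel_set u) \<subseteq> borel_set (u + xvar n)"
    by (auto simp: mulvars_def borel_set_iff[OF u] borel_set_iff[OF un] mons_add_iff xvar_in_mons_iff
        mdeg_add mdeg_xpow msum_add msum_xpow le_SucI trans_le_add1)
  show "borel_set (u + xvar n) \<subseteq> mulvars n (borel_set u)"
  proof
    fix y assume "y \<in> borel_set (u + xvar n)"
    then have y: "y \<in> mons n" "mdeg y = mdeg u + 1" "\<And>i. msum (u + xvar n) i \<le> msum y i"
      by (auto simp: borel_set_iff[OF un] mdeg_add mdeg_xpow)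
    have "y \<noteq> 0" using y(2) by (auto simp: mdeg_def)
    then obtain m w where m: "1 \<le> m" "m \<le> n" "y \<in> mons m" "y = w + xvar m" "w \<in> mons m"
      using mons_last_var y(1) by metis
    have dw: "mdeg w = mdeg u" using y(2) m(4) by (simp add: mdeg_add mdeg_xpow)
    have "msum u i \<le> msum w i" for i
    proof (cases "i < m")
      case True
      then show ?thesis using y(3)[of i] m by (auto simp: msum_add msum_xpow)
    next
      case False
      have "msum u i \<le> msum u (max i n)" by (rule msum_mono) simp
      then show ?thesis using False msum_mdeg[OF m(5), of i] msum_mdeg[OF u, of "max i n"] dw by auto
    qed
    then have "w \<in> borel_set u" using dw m mons_mono by (auto simp: borel_set_iff[OF u])
    then show "y \<in> mulvars n (borel_set u)" using m by (auto simp: mulvars_def)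
  qed
qed

lemma mulvars_lex_ge:
  assumes u: "u \<in> mons n" and n: "1 \<le> n"
  shows "mulvars n (lex_ge n u) = lex_ge n (u + xvar n)"
proof
  show "mulvars n (lex_ge n u) \<subseteq> lex_ge n (u + xvar n)"
    using xvar_mono by (auto simp: mulvars_def lex_ge_def mons_deg_def mons_add_iff xvar_in_mons_iff
        mdeg_add mdeg_xpow intro!: add_mono)
  show "lex_ge n (u + xvar n) \<subseteq> mulvars n (lex_ge n u)"
  proof
    fix y assume "y \<in> lex_ge n (u + xvar n)"
    then have y: "y \<in> mons n" "mdeg y = mdeg u + 1" "u + xvar n \<le> y"
      by (auto simp: lex_ge_def mons_deg_def mdeg_add mdeg_xpow)
    have "y \<noteq> 0" using y(2) by (auto simp: mdeg_def)
    then obtain m w where m: "1 \<le> m" "m \<le> n" "y \<in> mons m" "y = w + xvar m" "w \<in> mons m"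
      using mons_last_var y(1) by metis
    have dw: "mdeg w = mdeg u" using y(2) m(4) by (simp add: mdeg_add mdeg_xpow)
    \<comment> \<open>The first difference would lie below \<open>m\<close>, because
      \<open>w\<close> has full degree from \<open>m\<close> on. The factors x_m and x_n do not
      touch it, so \<open>y\<close> would be below \<open>u + xvar n\<close>.\<close>
    have "\<not> w < u"
    proof
      assume "w < u"
      then obtain k where k: "msum w k < msum u k" "\<And>j. j < k \<Longrightarrow> expo w j = expo u j"
        using mon_less_msum by blast
      have "msum u k \<le> msum u (max k n)" by (rule msum_mono) simp
      then have le: "msum u k \<le> mdeg u" using msum_mdeg[OF u] by simp
      have km: "k < m" using k(1) le msum_mdeg[OF m(5), of k] dw by (cases "k < m") auto
      have "expo w k < expo u k"
        using k msum_cong[of "k - 1" w u] msum_diff[of k w] msum_diff[of k u]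
        by (cases "k = 0") (auto simp: msum_less_first)
      then have "expo y k < expo (u + xvar n) k" "\<forall>j<k. expo y j = expo (u + xvar n) j"
        using k km m by (auto simp: lookup_add expo_xpow)
      then have "y < u + xvar n" by (auto simp: mon_less_iff)
      then show False using y(3) by simp
    qed
    then have "w \<in> lex_ge n u" using m dw mons_mono by (auto simp: lex_ge_def mons_deg_def)
    then show "y \<in> mulvars n (lex_ge n u)" using m by (auto simp: mulvars_def)
  qed
qed

section \<open>Macaulay's inequality for stable sets\<close>

definition lexseg :: "nat \<Rightarrow> nat \<Rightarrow> mon set \<Rightarrow> bool" where
  "lexseg n d L \<longleftrightarrow> L \<subseteq> mons_deg n d \<and> (\<forall>x\<in>L. \<forall>y\<in>mons_deg n d. x \<le> y \<longrightarrow> y \<in> L)"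

lemma lexseg_finite: "lexseg n d L \<Longrightarrow> finite L"
  using finite_subset[OF _ finite_mons_deg] by (auto simp: lexseg_def)

lemma lexseg_lex_ge: "lexseg n (mdeg u) (lex_ge n u)"
  by (auto simp: lexseg_def lex_ge_def)

text \<open>The order is total, so segments of one degree form a chain: an element of
  \<open>L\<close> outside \<open>M\<close> lies below all of \<open>M\<close>, which puts
  \<open>M\<close> inside \<open>L\<close>.\<close>

lemma lexseg_subset:
  assumes L: "lexseg n d L" and M: "lexseg n d M" and le: "card L \<le> card M"
  shows "L \<subseteq> M"
proof (rule ccontr)
  assume "\<not> L \<subseteq> M"
  then obtain x where x: "x \<in> L" "x \<notin> M" by auto
  have "M \<subseteq> L"
  proof
    fix m assume m: "m \<in> M"
    have "\<not> m \<le> x" using m x L M by (auto simp: lexseg_def)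
    then show "m \<in> L" using m x L M by (auto simp: lexseg_def)
  qed
  then have "M = L" using card_seteq[OF lexseg_finite[OF L] _ le] by simp
  with x show False by simp
qed

lemma lexseg_unique:
  "lexseg n d L \<Longrightarrow> lexseg n d M \<Longrightarrow> card L = card M \<Longrightarrow> L = M"
  using lexseg_subset[of n d L M] lexseg_subset[of n d M L] by auto

lemma lexseg_Int_mons:
  assumes "lexseg n d L" "m \<le> n"
  shows "lexseg m d (L \<inter> mons m)"
  unfolding lexseg_def
proof (intro conjI ballI impI)
  show "L \<inter> mons m \<subseteq> mons_deg m d"
    using assms(1) by (auto simp: lexseg_def mons_deg_def)
  fix x y assume xy: "x \<in> L \<inter> mons m" "y \<in> mons_deg m d" "x \<le> y"
  then have "y \<in> mons_deg n d" "y \<in> mons m" using mons_mono[OF assms(2)] by (auto simp: mons_deg_def)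
  then show "y \<in> L \<inter> mons m" using xy assms(1) by (auto simp: lexseg_def)
qed

text \<open>Segments are built by adding the largest missing monomial, one at a time.\<close>

lemma lexseg_exists:
  assumes "m \<le> card (mons_deg n d)"
  obtains L where "lexseg n d L" "card L = m"
proof -
  have "m \<le> card (mons_deg n d) \<Longrightarrow> \<exists>L. lexseg n d L \<and> card L = m" for m
  proof (induction m)
    case 0
    then show ?case by (intro exI[of _ "{}"]) (simp add: lexseg_def)
  next
    case (Suc m)
    then obtain L where L: "lexseg n d L" "card L = m" by auto
    let ?R = "mons_deg n d - L"
    have fin: "finite ?R" using finite_mons_deg by blast
    have "card L < card (mons_deg n d)" using L Suc.prems by simp
    then have "?R \<noteq> {}" using L card_mono[OF lexseg_finite[OF L(1)], of "mons_deg n d"] by auto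
    then have M: "Max ?R \<in> ?R" using fin by (rule Max_in[rotated])
    have "lexseg n d (insert (Max ?R) L)"
      unfolding lexseg_def
    proof (intro conjI ballI impI)
      show "insert (Max ?R) L \<subseteq> mons_deg n d" using M L by (auto simp: lexseg_def)
      fix x y assume xy: "x \<in> insert (Max ?R) L" "y \<in> mons_deg n d" "x \<le> y"
      show "y \<in> insert (Max ?R) L"
      proof (cases "x \<in> L")
        case True
        then show ?thesis using xy L by (auto simp: lexseg_def)
      next
        case False
        then have "Max ?R \<le> y" using xy by simp
        moreover have "y \<le> Max ?R" if "y \<notin> L" using that xy fin by (intro Max_ge) auto
        ultimately show ?thesis using antisym[of y "Max ?R"] by auto
      qed
    qed
    moreover have "card (insert (Max ?R) L) = Suc m"
      using L M lexseg_finite by simp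
    ultimately show ?case by blast
  qed
  then show thesis using assms that by blast
qed

lemma lexseg_eq_lex_ge:
  assumes L: "lexseg n d L" and ne: "L \<noteq> {}"
  obtains v where "v \<in> L" "v \<in> mons n" "mdeg v = d" "L = lex_ge n v"
proof
  have fin: "finite L" using L by (rule lexseg_finite)
  show m: "Min L \<in> L" using fin ne by (rule Min_in)
  then show "Min L \<in> mons n" and d: "mdeg (Min L) = d" using L by (auto simp: lexseg_def mons_deg_def)
  show "L = lex_ge n (Min L)"
  proof
    show "L \<subseteq> lex_ge n (Min L)"
      using fin L d by (auto simp: lex_ge_def lexseg_def)
    show "lex_ge n (Min L) \<subseteq> L"
      using m L d by (auto simp: lex_ge_def lexseg_def)
  qed
qed

section \<open>Colons and slices with respect to the last variable\<close>

definition colon :: "nat \<Rightarrow> mon set \<Rightarrow> nat \<Rightarrow> mon set" where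
  "colon n A j = {y. y + xpow n j \<in> A}"

lemma colon_0: "colon n A 0 = A"
  by (simp add: colon_def)

lemma colon_Suc: "colon n A (Suc j) = colon n (colon n A j) 1"
proof -
  have "xpow n (Suc j) = xvar n + xpow n j" by (simp add: plus_1_eq_Suc flip: single_add)
  then show ?thesis by (simp add: colon_def add.assoc)
qed

lemma colon_mono: "A \<subseteq> B \<Longrightarrow> colon n A j \<subseteq> colon n B j"
  by (auto simp: colon_def)

lemma colon_subset: "A \<subseteq> mons_deg n d \<Longrightarrow> colon n A j \<subseteq> mons_deg n (d - j)"
  by (auto simp: colon_def mons_deg_def mons_add_iff mdeg_add mdeg_xpow dest!: subsetD)

lemma colon_stable:
  assumes "borel_stable A"
  shows "borel_stable (colon n A j)"
proof -
  have "v + xvar i + a = v + a + xvar i" for v a :: mon and i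
    by (simp add: ac_simps)
  then show ?thesis using assms by (simp add: borel_stable_def colon_def)
qed

lemma colon_lexseg:
  assumes L: "lexseg n d L" and n: "1 \<le> n"
  shows "lexseg n (d - j) (colon n L j)"
  unfolding lexseg_def
proof (intro conjI ballI impI)
  show "colon n L j \<subseteq> mons_deg n (d - j)" using L colon_subset by (auto simp: lexseg_def)
  fix x y assume xy: "x \<in> colon n L j" "y \<in> mons_deg n (d - j)" "x \<le> y"
  then have xL: "x + xpow n j \<in> L" by (simp add: colon_def)
  \<comment> \<open>A member of the colon forces \<open>j \<le> d\<close>, so \<open>d - j\<close>
    is not truncated here.\<close>
  then have "mdeg x + j = d" using L by (auto simp: lexseg_def mons_deg_def mdeg_add mdeg_xpow)
  then have "y + xpow n j \<in> mons_deg n d"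
    using xy n by (auto simp: mons_deg_def mons_add_iff mdeg_add mdeg_xpow xpow_in_mons)
  moreover have "x + xpow n j \<le> y + xpow n j" using xy by (intro add_right_mono)
  ultimately have "y + xpow n j \<in> L" using L xL by (auto simp: lexseg_def)
  then show "y \<in> colon n L j" by (simp add: colon_def)
qed

text \<open>Sorts \<open>A\<close> by the exact exponent \<open>j\<close> of the last variable;
  dividing by that power leaves the elements of the colon free of this variable.\<close>

lemma card_split_slices:
  assumes A: "A \<subseteq> mons_deg (Suc n) d"
  shows "card A = (\<Sum>j\<le>d. card (colon (Suc n) A j \<inter> mons n))"
proof -
  let ?S = "\<lambda>j. (\<lambda>y. y + xpow (Suc n) j) ` (colon (Suc n) A j \<inter> mons n)"
  have fin: "finite A" using finite_subset[OF A finite_mons_deg] .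
  have sub: "?S j \<subseteq> A" for j by (auto simp: colon_def)
  have ex: "expo v (Suc n) = j" if "v \<in> ?S j" for v j
    using that by (auto simp: lookup_add mons_iff)
  have "A = (\<Union>j\<in>{..d}. ?S j)"
  proof
    show "A \<subseteq> (\<Union>j\<in>{..d}. ?S j)"
    proof
      fix v assume v: "v \<in> A"
      define j where "j = expo v (Suc n)"
      have jd: "j \<le> d" using v A expo_le_mdeg[of v "Suc n"] by (auto simp: j_def mons_deg_def)
      obtain w where w: "v = w + xpow (Suc n) j" "expo w (Suc n) = 0"
        using expo_ge_split[of j v "Suc n"] by (auto simp: j_def)
      have wS: "w \<in> mons (Suc n)" using v A w by (auto simp: mons_deg_def mons_add_iff)
      have "expo w i = 0" if "n < i" for i
        using wS w(2) that by (cases "i = Suc n") (auto simp: mons_iff)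
      then have "w \<in> mons n" using wS by (auto simp: mons_iff)
      then have "v \<in> ?S j" using w v by (auto simp: colon_def)
      then show "v \<in> (\<Union>j\<in>{..d}. ?S j)" using jd by blast
    qed
  qed (use sub in blast)
  then have "card A = card (\<Union>j\<in>{..d}. ?S j)" by simp
  also have "\<dots> = (\<Sum>j\<in>{..d}. card (?S j))"
  proof (rule card_UN_disjoint)
    show "\<forall>i\<in>{..d}. finite (?S i)" using finite_subset[OF sub fin] by blast
    show "\<forall>i\<in>{..d}. \<forall>j\<in>{..d}. i \<noteq> j \<longrightarrow> ?S i \<inter> ?S j = {}"
      using ex by (metis (no_types, lifting) disjoint_iff)
  qed simp
  also have "\<dots> = (\<Sum>j\<le>d. card (colon (Suc n) A j \<inter> mons n))"
    by (intro sum.cong refl card_image) (auto simp: inj_on_def)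
  finally show ?thesis .
qed

text \<open>Separates the multiples of the last variable. For sets of equal size, fewer elements in
  \<open>mons n\<close> thus means a larger colon.\<close>

lemma card_colon_1:
  assumes A: "A \<subseteq> mons_deg (Suc n) d"
  shows "card A = card (A \<inter> mons n) + card (colon (Suc n) A 1)"
proof -
  let ?S = "(\<lambda>y. y + xvar (Suc n)) ` colon (Suc n) A 1"
  have fin: "finite A" using finite_subset[OF A finite_mons_deg] .
  have eq: "A = (A \<inter> mons n) \<union> ?S"
  proof
    show "A \<subseteq> (A \<inter> mons n) \<union> ?S"
    proof
      fix v assume v: "v \<in> A"
      show "v \<in> (A \<inter> mons n) \<union> ?S"
      proof (cases "v \<in> mons n")
        case True then show ?thesis using v by simp
      next
        case False
        then obtain w where "v = w + xvar (Suc n)"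
          using mons_split_last v A unfolding mons_deg_def by blast
        then show ?thesis using v by (auto simp: colon_def)
      qed
    qed
  qed (auto simp: colon_def)
  have "card A = card (A \<inter> mons n) + card ?S"
    by (subst eq, rule card_Un_disjoint)
      (use fin eq in \<open>auto simp: mons_add_iff xvar_in_mons_iff intro: finite_subset[of _ A]\<close>)
  also have "card ?S = card (colon (Suc n) A 1)"
    by (intro card_image) (auto simp: inj_on_def)
  finally show ?thesis .
qed

lemma finite_colon: "A \<subseteq> mons_deg n d \<Longrightarrow> finite (colon n A j)"
  using finite_subset[OF colon_subset finite_mons_deg] .

text \<open>
  The induction step compares \<open>B\<close> and \<open>L\<close> slice by slice with respect to the last variable: a slice
  of \<open>B\<close> is contained in a colon of its zeroth slice, whereas a slice of \<open>L\<close> contains the corresponding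
  colon of any lexicographic segment strictly smaller than its zeroth slice.
\<close>

theorem card_lexseg_Int_mons_le:
  assumes "B \<subseteq> mons_deg (Suc n) d" "borel_stable B" "lexseg (Suc n) d L" "card L \<le> card B"
  shows "card (L \<inter> mons n) \<le> card (B \<inter> mons n)"
  using assms
proof (induction n arbitrary: d B L)
  case 0
  show ?case
  proof (cases d)
    case (Suc d')
    then show ?thesis using mons_deg_Int_mons_0[of L] 0 by (auto simp: lexseg_def)
  next
    case 0
    have "A \<inter> mons 0 = A" if "A \<subseteq> mons_deg (Suc 0) d" for A
    proof -
      have "x = 0" if "x \<in> A" for x
      proof -
        have "mdeg x = 0" using \<open>x \<in> A\<close> \<open>A \<subseteq> _\<close> 0 unfolding mons_deg_def by blast
        then show ?thesis by (simp add: mdeg_eq_0_iff)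
      qed
      then show ?thesis by (auto simp: mons_0_eq)
    qed
    then show ?thesis using \<open>card L \<le> card B\<close> \<open>B \<subseteq> _\<close> \<open>lexseg _ _ L\<close> by (auto simp: lexseg_def)
  qed
next
  case (Suc n)
  let ?m = "Suc n" and ?N = "Suc (Suc n)"
  \<comment> \<open>By the induction hypothesis a segment \<open>M'\<close> of the size of
    \<open>A\<close> has at most as many elements in \<open>mons n\<close>, hence at least as many
    multiples of the last variable; and \<open>M'\<close> is part of \<open>M\<close>.\<close>
  have colon_1: "card (colon ?m A 1) \<le> card (colon ?m M 1)"
    if A: "A \<subseteq> mons_deg ?m e" "borel_stable A" and M: "lexseg ?m e M" and le: "card A \<le> card M" for e A M
  proof -
    have "card A \<le> card (mons_deg ?m e)" using A(1) finite_mons_deg by (rule card_mono[rotated])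
    then obtain M' where M': "lexseg ?m e M'" "card M' = card A" by (rule lexseg_exists)
    have sub: "M' \<subseteq> M" "M \<subseteq> mons_deg ?m e" "M' \<subseteq> mons_deg ?m e"
      using lexseg_subset[OF M'(1) M] le M' M by (auto simp: lexseg_def)
    have "card (M' \<inter> mons n) \<le> card (A \<inter> mons n)" using Suc.IH[OF A M'(1)] M' by simp
    then have "card (colon ?m A 1) \<le> card (colon ?m M' 1)"
      using card_colon_1[OF A(1)] card_colon_1[OF sub(3)] M'(2) by linarith
    also have "\<dots> \<le> card (colon ?m M 1)"
      using colon_mono[OF sub(1)] finite_colon[OF sub(2)] by (intro card_mono)
    finally show ?thesis .
  qed
  \<comment> \<open>Colons of stable sets are stable and colons of segments are segments, so the
    bound for one division iterates.\<close>
  have colon_j: "card (colon ?m A j) \<le> card (colon ?m M j)"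
    if A: "A \<subseteq> mons_deg ?m e" "borel_stable A" and M: "lexseg ?m e M" and le: "card A \<le> card M" for e A M j
  proof (induction j)
    case 0
    then show ?case using le by (simp add: colon_0)
  next
    case (Suc j)
    have "1 \<le> ?m" by simp
    show ?case unfolding colon_Suc
      by (rule colon_1[OF colon_subset[OF A(1)] colon_stable[OF A(2)] colon_lexseg[OF M \<open>1 \<le> ?m\<close>] Suc])
  qed
  have Lsub: "L \<subseteq> mons_deg ?N d" using Suc.prems by (simp add: lexseg_def)
  have L0: "lexseg ?m d (L \<inter> mons ?m)" using Suc.prems(3) by (rule lexseg_Int_mons) simp
  have B0: "B \<inter> mons ?m \<subseteq> mons_deg ?m d" using Suc.prems(1) by (auto simp: mons_deg_def)
  show ?case
  proof (rule ccontr)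
    assume "\<not> ?case"
    then have less: "card (B \<inter> mons ?m) < card (L \<inter> mons ?m)" by simp
    have "card (B \<inter> mons ?m) \<le> card (mons_deg ?m d)" using B0 finite_mons_deg by (rule card_mono[rotated])
    \<comment> \<open>\<open>M\<close> is the segment as large as the zeroth slice of
      \<open>B\<close>. By assumption it is a proper part of the zeroth slice of \<open>L\<close>,
      as \<open>p\<close> will witness.\<close>
    then obtain M where M: "lexseg ?m d M" "card M = card (B \<inter> mons ?m)" by (rule lexseg_exists)
    have M_sub: "M \<subseteq> L \<inter> mons ?m" using lexseg_subset[OF M(1) L0] less M(2) by simp
    then obtain p where p: "p \<in> L" "p \<in> mons ?m" "p \<notin> M" using less M(2) by (metis IntE less_irrefl subsetI subset_antisym)
    have Msub: "M \<subseteq> mons_deg ?m d" using M by (simp add: lexseg_def)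
    have pd: "mdeg p = d" "p \<in> mons_deg ?m d" using p Lsub by (auto simp: mons_deg_def)
    have B_le: "card (colon ?N B j \<inter> mons ?m) \<le> card (colon ?m M j)" for j
    proof -
      \<comment> \<open>Stability trades the power of the last variable for the same power of the
        preceding one.\<close>
      have "colon ?N B j \<inter> mons ?m \<subseteq> colon ?m (B \<inter> mons ?m) j"
        using stableD_pow[OF Suc.prems(2), of ?m ?N] by (auto simp: colon_def mons_add_iff xpow_in_mons)
      then have "card (colon ?N B j \<inter> mons ?m) \<le> card (colon ?m (B \<inter> mons ?m) j)"
        using finite_colon[OF B0] by (intro card_mono)
      also have "\<dots> \<le> card (colon ?m M j)"
        using colon_j[OF B0 stable_Int_mons[OF Suc.prems(2)] M(1)] M(2) by simp
      finally show ?thesis .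
    qed
    have L_ge: "colon ?m M j \<subseteq> colon ?N L j \<inter> mons ?m" for j
    proof
      fix y assume "y \<in> colon ?m M j"
      then have yM: "y + xpow ?m j \<in> M" by (simp add: colon_def)
      then have ym: "y \<in> mons ?m" and yd: "mdeg y + j = d"
        using Msub by (auto simp: mons_deg_def mons_add_iff mdeg_add mdeg_xpow)
      have "\<not> y + xpow ?m j \<le> p" using yM p pd M by (auto simp: lexseg_def)
      then have "p < y + xpow ?m j" by simp
      then obtain k where k: "expo p k < expo (y + xpow ?m j) k" "\<And>i. i < k \<Longrightarrow> expo p i = expo (y + xpow ?m j) i"
        by (auto simp: mon_less_iff)
      \<comment> \<open>Distinct monomials of equal degree in \<open>?m\<close> variables differ
        before the last one. The comparison with \<open>p\<close> therefore survives replacing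
        \<open>xpow ?m j\<close> by \<open>xpow ?N j\<close>.\<close>
      have "k < ?m"
      proof (rule ccontr)
        assume "\<not> k < ?m"
        then have "p = y + xpow ?m j"
          using p ym pd yd k(2) by (intro mons_deg_eqI[of _ ?m]) (auto simp: mons_add_iff xpow_in_mons mdeg_add mdeg_xpow)
        with k show False by simp
      qed
      then have "p < y + xpow ?N j"
        using k by (auto simp: mon_less_iff lookup_add expo_xpow intro!: exI[of _ k])
      moreover have "y + xpow ?N j \<in> mons_deg ?N d"
        using ym yd mons_mono[of ?m ?N] by (auto simp: mons_deg_def mons_add_iff xpow_in_mons mdeg_add mdeg_xpow)
      ultimately have "y + xpow ?N j \<in> L" using p Suc.prems(3) unfolding lexseg_def by (metis order.strict_implies_order)
      then show "y \<in> colon ?N L j \<inter> mons ?m" using ym by (simp add: colon_def)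
    qed
    have finL: "finite (colon ?N L j \<inter> mons ?m)" for j using finite_colon[OF Lsub] by simp
    have "card B = (\<Sum>j\<le>d. card (colon ?N B j \<inter> mons ?m))" by (rule card_split_slices[OF Suc.prems(1)])
    also have "\<dots> \<le> (\<Sum>j\<le>d. card (colon ?m M j))" by (intro sum_mono B_le)
    also have "\<dots> < (\<Sum>j\<le>d. card (colon ?N L j \<inter> mons ?m))"
    proof (rule sum_strict_mono_ex1)
      show "\<forall>j\<in>{..d}. card (colon ?m M j) \<le> card (colon ?N L j \<inter> mons ?m)"
        using card_mono[OF finL L_ge] by blast
      \<comment> \<open>Strictness comes from the zeroth slice, where the choice of \<open>M\<close>
        applies.\<close>
      show "\<exists>j\<in>{..d}. card (colon ?m M j) < card (colon ?N L j \<inter> mons ?m)"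
        using less M(2) by (intro bexI[of _ 0]) (auto simp: colon_0)
    qed simp
    also have "\<dots> = card L" by (rule card_split_slices[OF Lsub, symmetric])
    finally show False using Suc.prems(4) by simp
  qed
qed

text \<open>Descends from \<open>n\<close> to \<open>m\<close> one variable at a time; each
  conclusion is the size hypothesis of the next step.\<close>

lemma card_lexseg_Int_mons_le':
  assumes "B \<subseteq> mons_deg n d" "borel_stable B" "lexseg n d L" "card L \<le> card B" "m \<le> n"
  shows "card (L \<inter> mons m) \<le> card (B \<inter> mons m)"
  using assms(5)
proof (induction rule: inc_induct)
  case base
  have "L \<inter> mons n = L" "B \<inter> mons n = B" using assms(1,3) by (auto simp: lexseg_def mons_deg_def)
  then show ?case using assms(4) by simp
next
  case (step m)
  have eq: "A \<inter> mons (Suc m) \<inter> mons m = A \<inter> mons m" for A using mons_mono[of m "Suc m"] by auto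
  have "B \<inter> mons (Suc m) \<subseteq> mons_deg (Suc m) d" using assms(1) by (auto simp: mons_deg_def)
  from card_lexseg_Int_mons_le[OF this stable_Int_mons[OF assms(2)] lexseg_Int_mons[OF assms(3)] step.IH] step.hyps
  show ?case by (simp add: eq)
qed

section \<open>Monomial ideals and their Hilbert functions\<close>

lemma xpow_Suc: "u + xpow n (Suc s) = u + xpow n s + xvar n"
  by (simp add: Suc_eq_plus1 add.assoc single_add)

text \<open>For \<open>B\<close> inside \<open>mons n\<close> these are the monomials lying in
  \<open>mon_ideal n B\<close>.\<close>

definition mon_upset :: "nat \<Rightarrow> mon set \<Rightarrow> mon set" where
  "mon_upset n B = {b + m | b m. b \<in> B \<and> m \<in> mons n}"

lemma poly_mapping_sum_single: "(\<Sum>v\<in>Poly_Mapping.keys p. Poly_Mapping.single v (Poly_Mapping.lookup p v)) = p"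
  by (rule poly_mapping_eqI) (simp add: lookup_sum lookup_single when_def in_keys_iff)

lemma poly_ring_a_inv:
  assumes "p \<in> carrier (poly_ring n :: ('k::field) mpol ring)"
  shows "\<ominus>\<^bsub>poly_ring n\<^esub> p = - p"
proof -
  interpret cring "poly_ring n :: 'k mpol ring" by (rule cring_poly_ring)
  show ?thesis
    using assms by (intro minus_equality) (auto simp: poly_ring_def in_keys_iff subset_iff)
qed

lemma ideal_mon_upset:
  assumes B: "B \<subseteq> mons n"
  shows "ideal {p :: ('k::field) mpol. Poly_Mapping.keys p \<subseteq> mon_upset n B} (poly_ring n)"
    (is "ideal ?I ?R")
proof -
  interpret R: cring ?R by (rule cring_poly_ring)
  have sub: "mon_upset n B \<subseteq> mons n"
    using B by (auto simp: mon_upset_def mons_add)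
  have I_carrier: "?I \<subseteq> carrier ?R" using sub by (auto simp: poly_ring_def)
  have mult: "x * a \<in> ?I" if a: "a \<in> ?I" and x: "x \<in> carrier ?R" for a x
  proof -
    have "v + w \<in> mon_upset n B" if "v \<in> mons n" "w \<in> mon_upset n B" for v w
    proof -
      obtain b m where "w = b + m" "b \<in> B" "m \<in> mons n" using \<open>w \<in> mon_upset n B\<close> by (auto simp: mon_upset_def)
      then have "v + w = b + (v + m)" "v + m \<in> mons n" using that mons_add by (auto simp: ac_simps)
      then show ?thesis using \<open>b \<in> B\<close> by (auto simp: mon_upset_def)
    qed
    then have "{v + w | v w. v \<in> Poly_Mapping.keys x \<and> w \<in> Poly_Mapping.keys a} \<subseteq> mon_upset n B"
      using a x by (auto simp: poly_ring_def)
    then show ?thesis using keys_mult[of x a] by blast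
  qed
  show ?thesis
  proof (rule idealI)
    show "ring ?R" by (rule R.ring_axioms)
    show "subgroup ?I (add_monoid ?R)"
    proof (rule R.add.subgroupI)
      show "?I \<subseteq> carrier ?R" by (rule I_carrier)
      show "?I \<noteq> {}" by (auto intro!: exI[of _ 0])
      fix a assume a: "a \<in> ?I"
      then have "\<ominus>\<^bsub>?R\<^esub> a = - a" using I_carrier by (intro poly_ring_a_inv) blast
      then show "\<ominus>\<^bsub>?R\<^esub> a \<in> ?I" using a by (auto simp: in_keys_iff)
      fix b assume "b \<in> ?I"
      then show "a \<oplus>\<^bsub>?R\<^esub> b \<in> ?I"
        using a keys_add[of a b] by (auto simp: poly_ring_def)
    qed
    fix a x assume "a \<in> ?I" "x \<in> carrier ?R"
    then have "x * a \<in> ?I" by (rule mult)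
    then show "x \<otimes>\<^bsub>?R\<^esub> a \<in> ?I" "a \<otimes>\<^bsub>?R\<^esub> x \<in> ?I" by (simp_all add: poly_ring_def mult.commute)
  qed
qed

text \<open>One inclusion is minimality of the generated ideal; for the other, each term of a
  polynomial supported on \<open>mon_upset n B\<close> is a multiple of a generator.\<close>

lemma mon_ideal_eq:
  assumes B: "B \<subseteq> mons n"
  shows "(mon_ideal n B :: ('k::field) mpol set) = {p. Poly_Mapping.keys p \<subseteq> mon_upset n B}"
    (is "_ = ?I")
proof
  let ?R = "poly_ring n :: 'k mpol ring"
  interpret R: cring ?R by (rule cring_poly_ring)
  have "(\<lambda>v. Poly_Mapping.single v 1) ` B \<subseteq> ?I"
    using mons_0[of n] by (force simp: mon_upset_def)
  then show "mon_ideal n B \<subseteq> ?I"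
    unfolding mon_ideal_def by (intro R.genideal_minimal ideal_mon_upset[OF B])
  have gens: "(\<lambda>v. Poly_Mapping.single v (1::'k)) ` B \<subseteq> carrier ?R"
    using B by (auto simp: poly_ring_def)
  interpret J: ideal "mon_ideal n B" ?R
    unfolding mon_ideal_def by (rule R.genideal_ideal[OF gens])
  have single: "Poly_Mapping.single v c \<in> mon_ideal n B" if "v \<in> mon_upset n B" for v and c :: 'k
  proof -
    obtain b m where bm: "v = b + m" "b \<in> B" "m \<in> mons n" using \<open>v \<in> mon_upset n B\<close> by (auto simp: mon_upset_def)
    have "Poly_Mapping.single b (1 :: 'k) \<in> mon_ideal n B"
      unfolding mon_ideal_def by (rule subsetD[OF R.genideal_self[OF gens]], rule imageI, rule bm)
    moreover have "Poly_Mapping.single m c \<in> carrier ?R" using bm by (auto simp: poly_ring_def)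
    ultimately have "Poly_Mapping.single b 1 \<otimes>\<^bsub>?R\<^esub> Poly_Mapping.single m c \<in> mon_ideal n B"
      by (rule J.I_r_closed)
    then show ?thesis using bm by (simp add: poly_ring_def mult_single)
  qed
  have sum: "(\<Sum>v\<in>F. Poly_Mapping.single v (c v)) \<in> mon_ideal n B"
    if "finite F" "F \<subseteq> mon_upset n B" for F and c :: "mon \<Rightarrow> 'k"
    using that
  proof (induction F)
    case empty
    have "\<zero>\<^bsub>?R\<^esub> \<in> mon_ideal n B" by (rule J.zero_closed)
    then show ?case by (simp add: poly_ring_def)
  next
    case (insert v F)
    then have "Poly_Mapping.single v (c v) \<oplus>\<^bsub>?R\<^esub> (\<Sum>v\<in>F. Poly_Mapping.single v (c v)) \<in> mon_ideal n B"
      by (intro J.a_closed single) auto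
    then show ?case using insert by (simp add: poly_ring_def)
  qed
  show "?I \<subseteq> mon_ideal n B"
  proof
    fix p assume "p \<in> ?I"
    then have "(\<Sum>v\<in>Poly_Mapping.keys p. Poly_Mapping.single v (Poly_Mapping.lookup p v)) \<in> mon_ideal n B"
      by (intro sum) auto
    then show "p \<in> mon_ideal n B"
      unfolding poly_mapping_sum_single .
  qed
qed

text \<open>The monomials in \<open>W\<close> form a basis.\<close>

lemma dim_keys_subset:
  assumes W: "finite W"
  shows "vector_space.dim (scale :: 'k::field \<Rightarrow> _) {p. Poly_Mapping.keys p \<subseteq> W} = card W"
proof -
  interpret V: vector_space "scale :: 'k \<Rightarrow> _" by (rule vector_space_scale)
  let ?s = "\<lambda>v :: mon. Poly_Mapping.single v (1 :: 'k)"
  have inj: "inj_on ?s W"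
    by (rule inj_onI) (metis keys_single singleton_inject zero_neq_one)
  have scale_single: "scale c (?s v) = Poly_Mapping.single v c" for c :: 'k and v
    by (simp add: scale_def mult_single)
  show ?thesis
  proof (rule V.dim_unique)
    show "?s ` W \<subseteq> {p. Poly_Mapping.keys p \<subseteq> W}" by auto
    show "{p. Poly_Mapping.keys p \<subseteq> W} \<subseteq> V.span (?s ` W)"
    proof
      fix p :: "'k mpol" assume p: "p \<in> {p. Poly_Mapping.keys p \<subseteq> W}"
      have "(\<Sum>v\<in>Poly_Mapping.keys p. scale (Poly_Mapping.lookup p v) (?s v)) \<in> V.span (?s ` W)"
        using p by (intro V.span_sum V.span_scale V.span_base) auto
      then show "p \<in> V.span (?s ` W)"
        unfolding scale_single poly_mapping_sum_single .
    qed
    show "V.independent (?s ` W)"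
    proof (rule V.independent_if_scalars_zero)
      fix f x assume sum: "(\<Sum>x\<in>?s ` W. scale (f x) x) = 0" and "x \<in> ?s ` W"
      then obtain v where v: "v \<in> W" "x = ?s v" by auto
      have "0 = (\<Sum>w\<in>W. Poly_Mapping.single w (f (?s w)))"
        using sum by (simp add: sum.reindex[OF inj] scale_single)
      then have "0 = Poly_Mapping.lookup (\<Sum>w\<in>W. Poly_Mapping.single w (f (?s w))) v" by simp
      also have "\<dots> = f x" using v W by (simp add: lookup_sum lookup_single when_def)
      finally show "f x = 0" by simp
    qed (use W in simp)
    show "card (?s ` W) = card W" using inj by (rule card_image)
  qed
qed

lemma hilb_mon_ideal:
  assumes "B \<subseteq> mons n"
  shows "hilb (mon_ideal n B :: ('k::field) mpol set) j = card (mon_upset n B \<inter> {v. mdeg v = j})"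
proof -
  have "mon_upset n B \<subseteq> mons n"
    using assms by (auto simp: mon_upset_def mons_add)
  then have fin: "finite (mon_upset n B \<inter> {v. mdeg v = j})"
    by (intro finite_subset[OF _ finite_mons_deg[of n j]]) (auto simp: mons_deg_def)
  have "{p \<in> (mon_ideal n B :: 'k mpol set). \<forall>v\<in>Poly_Mapping.keys p. mdeg v = j} =
      {p. Poly_Mapping.keys p \<subseteq> mon_upset n B \<inter> {v. mdeg v = j}}"
    unfolding mon_ideal_eq[OF assms] by auto
  then show ?thesis unfolding hilb_def using dim_keys_subset[OF fin] by simp
qed

text \<open>Below \<open>n\<close> the factor x_n^s adds nothing to the partial degrees, and from
  \<open>n\<close> on these are total degrees; this gives one inclusion. The other is an induction
  on \<open>s\<close> through \<open>mulvars_borel_set\<close>.\<close>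

lemma mon_upset_borel_set:
  assumes u: "u \<in> mons n" and n: "1 \<le> n"
  shows "mon_upset n (borel_set u) \<inter> {v. mdeg v = mdeg u + s} = borel_set (u + xpow n s)"
proof
  have un: "u + xpow n s \<in> mons n" for s using u n by (simp add: mons_add_iff xpow_in_mons)
  show "mon_upset n (borel_set u) \<inter> {v. mdeg v = mdeg u + s} \<subseteq> borel_set (u + xpow n s)"
  proof
    fix v assume "v \<in> mon_upset n (borel_set u) \<inter> {v. mdeg v = mdeg u + s}"
    then obtain b m where bm: "v = b + m" "b \<in> borel_set u" "m \<in> mons n" "mdeg v = mdeg u + s"
      by (auto simp: mon_upset_def)
    then have b: "b \<in> mons n" "mdeg b = mdeg u" "\<And>i. msum u i \<le> msum b i"
      by (auto simp: borel_set_iff[OF u])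
    have v: "v \<in> mons n" using bm b by (simp add: mons_add_iff)
    have "msum (u + xpow n s) i \<le> msum v i" for i
    proof (cases "i < n")
      case True
      then show ?thesis using b(3)[of i] bm(1) by (simp add: msum_add msum_xpow)
    next
      case False
      then show ?thesis using msum_mdeg[OF un, of i] msum_mdeg[OF v, of i] bm(4)
        by (simp add: mdeg_add mdeg_xpow)
    qed
    then show "v \<in> borel_set (u + xpow n s)"
      using v bm(4) by (simp add: borel_set_iff[OF un] mdeg_add mdeg_xpow)
  qed
  have "borel_set (u + xpow n s) \<subseteq> mon_upset n (borel_set u)"
  proof (induction s)
    case 0
    then show ?case using mons_0[of n] by (auto simp: mon_upset_def) (metis add.right_neutral)
  next
    case (Suc s)
    have "borel_set (u + xpow n (Suc s)) = mulvars n (borel_set (u + xpow n s))"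
      using mulvars_borel_set[OF un n] by (simp add: xpow_Suc)
    also have "\<dots> \<subseteq> mon_upset n (borel_set u)"
    proof
      fix v assume "v \<in> mulvars n (borel_set (u + xpow n s))"
      then obtain w i where w: "v = w + xvar i" "w \<in> borel_set (u + xpow n s)" "1 \<le> i" "i \<le> n"
        by (auto simp: mulvars_def)
      then obtain b m where bm: "w = b + m" "b \<in> borel_set u" "m \<in> mons n"
        using Suc by (auto simp: mon_upset_def)
      then have "v = b + (m + xvar i)" "m + xvar i \<in> mons n"
        using w by (auto simp: add.assoc mons_add_iff xvar_in_mons_iff)
      then show "v \<in> mon_upset n (borel_set u)" using bm by (auto simp: mon_upset_def)
    qed
    finally show ?case .
  qed
  moreover have "borel_set (u + xpow n s) \<subseteq> {v. mdeg v = mdeg u + s}"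
    by (auto simp: borel_set_iff[OF un] mdeg_add mdeg_xpow)
  ultimately show "borel_set (u + xpow n s) \<subseteq> mon_upset n (borel_set u) \<inter> {v. mdeg v = mdeg u + s}"
    by blast
qed

lemma hilb_borel_set:
  assumes u: "u \<in> mons n" and n: "1 \<le> n"
  shows "hilb (mon_ideal n (borel_set u) :: ('k::field) mpol set) (mdeg u + s) = card (borel_set (u + xpow n s))"
  using hilb_mon_ideal[of "borel_set u" n "mdeg u + s"] borel_set_subset[OF u] mon_upset_borel_set[OF assms]
  by (auto simp: mons_deg_def)

section \<open>A combinatorial criterion for Gotzmann monomials\<close>

text \<open>For \<open>n \<ge> 1\<close> the condition at \<open>m = n\<close> fixes the size of the
  segment, so at most one \<open>v\<close> qualifies; the conditions at smaller \<open>m\<close>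
  control growth.\<close>

definition lex_match :: "nat \<Rightarrow> mon \<Rightarrow> mon \<Rightarrow> bool" where
  "lex_match n u v \<longleftrightarrow> v \<in> lex_ge n u \<and>
     (\<forall>m\<in>{1..n}. card (borel_set u \<inter> mons m) = card (lex_ge n v \<inter> mons m))"

lemma lex_ge_iff: "v \<in> lex_ge n u \<longleftrightarrow> v \<in> mons n \<and> mdeg v = mdeg u \<and> u \<le> v"
  by (auto simp: lex_ge_def mons_deg_def)

text \<open>Multiplication by x_n turns both sequences of counts into their partial sums, and
  differencing recovers a sequence from its partial sums.\<close>

lemma lex_match_mulvars:
  assumes u: "u \<in> mons n" and n: "1 \<le> n"
  shows "lex_match n (u + xvar n) (v + xvar n) \<longleftrightarrow> lex_match n u v"
proof (cases "v \<in> lex_ge n u")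
  case False
  then show ?thesis using n by (auto simp: lex_match_def lex_ge_iff mons_add_iff xvar_in_mons_iff mdeg_add mdeg_xpow)
next
  case True
  then have v: "v \<in> mons n" "mdeg v = mdeg u" "u \<le> v" by (auto simp: lex_ge_iff)
  have v': "v + xvar n \<in> lex_ge n (u + xvar n)"
    using v n by (simp add: lex_ge_iff mons_add_iff xvar_in_mons_iff mdeg_add mdeg_xpow)
  have B: "card (borel_set (u + xvar n) \<inter> mons m) = (\<Sum>i\<in>{1..m}. card (borel_set u \<inter> mons i))"
    if "m \<le> n" for m
    using card_mulvars_sum[OF borel_set_stable borel_set_subset[OF u] that] mulvars_borel_set[OF u n] by simp
  have L: "card (lex_ge n (v + xvar n) \<inter> mons m) = (\<Sum>i\<in>{1..m}. card (lex_ge n v \<inter> mons i))"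
    if "m \<le> n" for m
    using card_mulvars_sum[OF lex_ge_stable lex_ge_subset[of n v] that] mulvars_lex_ge[OF v(1) n] by simp
  show ?thesis
  proof
    assume "lex_match n u v"
    then show "lex_match n (u + xvar n) (v + xvar n)"
      using v' B L by (auto simp: lex_match_def intro!: sum.cong)
  next
    assume m: "lex_match n (u + xvar n) (v + xvar n)"
    have eq: "(\<Sum>i\<in>{1..m}. card (borel_set u \<inter> mons i)) = (\<Sum>i\<in>{1..m}. card (lex_ge n v \<inter> mons i))"
      if "m \<le> n" for m
      using m B[OF that] L[OF that] that by (cases "m = 0") (auto simp: lex_match_def)
    have "card (borel_set u \<inter> mons (Suc m)) = card (lex_ge n v \<inter> mons (Suc m))" if "Suc m \<le> n" for m
      using eq[of m] eq[of "Suc m"] that by simp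
    then have "card (borel_set u \<inter> mons m) = card (lex_ge n v \<inter> mons m)" if "m \<in> {1..n}" for m
      using that by (cases m) auto
    then show "lex_match n u v" using True by (simp add: lex_match_def)
  qed
qed

lemma lex_match_xpow:
  assumes u: "u \<in> mons n" and n: "1 \<le> n"
  shows "lex_match n u v \<Longrightarrow> lex_match n (u + xpow n s) (v + xpow n s)"
proof (induction s)
  case (Suc s)
  have "u + xpow n s \<in> mons n" using u n by (simp add: mons_add_iff xpow_in_mons)
  then show ?case unfolding xpow_Suc using Suc n by (simp add: lex_match_mulvars)
qed simp

lemma lex_match_card:
  assumes "lex_match n u v" "u \<in> mons n" "1 \<le> n"
  shows "card (borel_set u) = card (lex_ge n v)"
proof -
  have "card (borel_set u \<inter> mons n) = card (lex_ge n v \<inter> mons n)"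
    using assms by (auto simp: lex_match_def)
  then show ?thesis using Int_mons_all[OF borel_set_subset[OF assms(2)]] Int_mons_all[OF lex_ge_subset] by simp
qed

text \<open>A member of \<open>L\<close> has fewer than \<open>card L\<close> monomials above it; a
  monomial of degree \<open>d\<close> outside \<open>L\<close> has all of \<open>L\<close> above
  it.\<close>

lemma lex_largest_eq:
  assumes L: "lexseg n d L"
  shows "lex_largest n d (card L) = L"
proof (rule Set.set_eqI)
  fix v
  have fin: "finite {z \<in> mons_deg n d. v < z}" using finite_mons_deg by simp
  show "v \<in> lex_largest n d (card L) \<longleftrightarrow> v \<in> L"
  proof (cases "v \<in> L")
    case True
    then have "{z \<in> mons_deg n d. v < z} \<subseteq> L - {v}" using L by (auto simp: lexseg_def)
    then have "card {z \<in> mons_deg n d. v < z} \<le> card (L - {v})"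
      using lexseg_finite[OF L] by (intro card_mono) auto
    also have "\<dots> < card L" using True lexseg_finite[OF L] by (intro card_Diff1_less)
    finally show ?thesis using True L by (auto simp: lex_largest_def lexseg_def)
  next
    case False
    have "card L \<le> card {z \<in> mons_deg n d. v < z}" if v: "v \<in> mons_deg n d"
    proof (rule card_mono[OF fin])
      show "L \<subseteq> {z \<in> mons_deg n d. v < z}"
      proof
        fix z assume z: "z \<in> L"
        then have "\<not> z \<le> v" using L v False by (auto simp: lexseg_def)
        then show "z \<in> {z \<in> mons_deg n d. v < z}" using z L by (auto simp: lexseg_def)
      qed
    qed
    then show ?thesis using False by (auto simp: lex_largest_def)
  qed
qed

text \<open>
  Growth is compared with that of the lexicographic segment of equal size. By Macaulay's inequality
  each summand in the growth formula of the segment is at most the one for \<open>borel_set u\<close>, so equal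
  growth in one degree forces termwise equality, which then persists in all higher degrees.
\<close>

theorem gotzmann_monomial_iff:
  assumes u: "u \<in> mons n" and n: "1 \<le> n"
  shows "gotzmann_monomial TYPE('k::field) n u \<longleftrightarrow> (\<exists>v. lex_match n u v)"
proof
  let ?I = "mon_ideal n (borel_set u) :: 'k mpol set"
  assume "\<exists>v. lex_match n u v"
  then obtain v where v: "lex_match n u v" by blast
  have "hilb ?I (j + 1) = card {w + xvar i | w i. w \<in> lex_largest n j (hilb ?I j) \<and> i \<in> {1..n}}"
    if "mdeg u \<le> j" for j
  proof -
    \<comment> \<open>Every degree from \<open>mdeg u\<close> on is reached by a power of x_n, and
      \<open>lex_match_xpow\<close> supplies a matching segment there.\<close>
    define s where "s = j - mdeg u"
    have j: "j = mdeg u + s" using that by (simp add: s_def)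
    have us: "u + xpow n s \<in> mons n" for s using u n by (simp add: mons_add_iff xpow_in_mons)
    have m: "lex_match n (u + xpow n s) (v + xpow n s)" for s using lex_match_xpow[OF u n v] .
    have vs: "v + xpow n s \<in> mons n" "mdeg (v + xpow n s) = j"
      using m[of s] by (auto simp: lex_match_def lex_ge_iff j mdeg_add mdeg_xpow)
    have "lex_largest n j (hilb ?I j) = lex_ge n (v + xpow n s)"
      using lex_largest_eq[OF lexseg_lex_ge, of n "v + xpow n s"] vs(2)
        lex_match_card[OF m us n] hilb_borel_set[OF u n, where 'k = 'k, of s] by (simp add: j)
    then have "{w + xvar i | w i. w \<in> lex_largest n j (hilb ?I j) \<and> i \<in> {1..n}} = lex_ge n (v + xpow n (Suc s))"
      unfolding xpow_Suc mulvars_lex_ge[OF vs(1) n, symmetric] by (simp add: mulvars_def)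
    moreover have "hilb ?I (j + 1) = card (borel_set (u + xpow n (Suc s)))"
      using hilb_borel_set[OF u n, where 'k = 'k, of "Suc s"] by (simp add: j Suc_eq_plus1 add.assoc)
    ultimately show ?thesis using lex_match_card[OF m us n] by simp
  qed
  then show "gotzmann_monomial TYPE('k) n u"
    unfolding gotzmann_monomial_def gotzmann_ideal_def using borel_set_subset[OF u] by blast
next
  let ?I = "mon_ideal n (borel_set u) :: 'k mpol set"
  let ?d = "mdeg u"
  assume "gotzmann_monomial TYPE('k) n u"
  then obtain e G where G: "G \<subseteq> mons_deg n e" "?I = mon_ideal n G"
    and H: "\<And>j. e \<le> j \<Longrightarrow> hilb ?I (j + 1) =
      card {w + xvar i | w i. w \<in> lex_largest n j (hilb ?I j) \<and> i \<in> {1..n}}"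
    unfolding gotzmann_monomial_def gotzmann_ideal_def by blast
  have Bsub: "borel_set u \<subseteq> mons_deg n ?d" by (rule borel_set_subset[OF u])
  have "borel_set u \<subseteq> mons n" "G \<subseteq> mons n" using Bsub G by (auto simp: mons_deg_def)
  then have "{p :: 'k mpol. Poly_Mapping.keys p \<subseteq> mon_upset n (borel_set u)} =
      {p. Poly_Mapping.keys p \<subseteq> mon_upset n G}"
    using G(2) by (simp add: mon_ideal_eq)
  moreover have "u \<in> mon_upset n (borel_set u)"
    unfolding mon_upset_def using mons_0[of n] borel_set.base[of u] by (metis (mono_tags, lifting) add.right_neutral mem_Collect_eq)
  then have "Poly_Mapping.single u (1 :: 'k) \<in> {p. Poly_Mapping.keys p \<subseteq> mon_upset n (borel_set u)}" by simp
  ultimately have "Poly_Mapping.single u (1 :: 'k) \<in> {p. Poly_Mapping.keys p \<subseteq> mon_upset n G}" by blast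
  then have "u \<in> mon_upset n G" by simp
  \<comment> \<open>The generating degree in \<open>gotzmann_ideal\<close> is arbitrary. As
    \<open>u\<close> is a multiple of a generator, it is at most \<open>?d\<close>, so the growth
    condition applies in degree \<open>?d\<close>.\<close>
  then have "e \<le> ?d" using G(1) by (auto simp: mon_upset_def mons_deg_def mdeg_add)
  have "card (borel_set u) \<le> card (mons_deg n ?d)" using Bsub finite_mons_deg by (rule card_mono[rotated])
  then obtain L where L: "lexseg n ?d L" "card L = card (borel_set u)" by (rule lexseg_exists)
  have "finite (borel_set u)" using finite_subset[OF Bsub finite_mons_deg] .
  then have "card (borel_set u) \<noteq> 0" using borel_set.base[of u] by auto
  then have "L \<noteq> {}" using L(2) by auto
  then obtain v where v: "v \<in> mons n" "mdeg v = ?d" "L = lex_ge n v" using lexseg_eq_lex_ge[OF L(1)] by metis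
  have Lsub: "L \<subseteq> mons_deg n ?d" using L by (simp add: lexseg_def)
  have "hilb ?I (?d + 1) = card (mulvars n L)"
    using H[OF \<open>e \<le> ?d\<close>] hilb_borel_set[OF u n, where 'k = 'k, of 0] lex_largest_eq[OF L(1)] L(2) by (simp add: mulvars_def)
  moreover have "hilb ?I (?d + 1) = card (mulvars n (borel_set u))"
    using hilb_borel_set[OF u n, where 'k = 'k, of 1] mulvars_borel_set[OF u n] by simp
  moreover have "card (mulvars n A) = (\<Sum>i\<in>{1..n}. card (A \<inter> mons i))"
    if "borel_stable A" "A \<subseteq> mons_deg n ?d" for A
    using card_mulvars_sum[OF that order_refl] Int_mons_all[OF mulvars_subset[OF that(2)]] by simp
  ultimately have sums: "(\<Sum>i\<in>{1..n}. card (L \<inter> mons i)) = (\<Sum>i\<in>{1..n}. card (borel_set u \<inter> mons i))"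
    using lex_ge_stable Lsub Bsub borel_set_stable v(3) by metis
  have "card (L \<inter> mons m) = card (borel_set u \<inter> mons m)" if "m \<in> {1..n}" for m
    by (rule sum_mono_inv[OF sums _ that])
      (use card_lexseg_Int_mons_le'[OF Bsub borel_set_stable L(1)] L(2) in auto)
  moreover have "v \<in> lex_ge n u"
  proof -
    have "card (borel_set u) \<le> card (lex_ge n u)"
      using borel_set_subset_lex_ge[OF u] finite_subset[OF lex_ge_subset finite_mons_deg] by (intro card_mono)
    then have "L \<subseteq> lex_ge n u" using lexseg_subset[OF L(1) lexseg_lex_ge] L(2) by simp
    moreover have "v \<in> L" using v by (simp add: lex_ge_iff)
    ultimately show ?thesis by blast
  qed
  ultimately show "\<exists>v. lex_match n u v" using v(3) by (auto simp: lex_match_def)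
qed

section \<open>Generators by last variable\<close>

lemma mons_iff_Max:
  assumes "u \<in> mons n" "u \<noteq> 0"
  shows "u \<in> mons i \<longleftrightarrow> Max (Poly_Mapping.keys u) \<le> i"
proof -
  have "Poly_Mapping.keys u \<noteq> {}" using assms(2) by simp
  then show ?thesis using assms(1) by (auto simp: mons_def Max_le_iff)
qed

text \<open>The exponent of x_{i+1} counts the elements with last variable x_{i+1}. The monomial 1
  is excluded because it has no last variable.\<close>

lemma expo_maxgen:
  assumes X: "X \<subseteq> mons_deg n d" "0 \<notin> X"
  shows "expo (maxgen X) (Suc i) + card (X \<inter> mons i) = card (X \<inter> mons (Suc i))"
proof -
  have fin: "finite X" using finite_subset[OF X(1) finite_mons_deg] .
  have iff: "u \<in> mons j \<longleftrightarrow> Max (Poly_Mapping.keys u) \<le> j" if "u \<in> X" for u j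
    using that X by (intro mons_iff_Max[of u n]) (auto simp: mons_deg_def)
  have "expo (maxgen X) (Suc i) = (\<Sum>u\<in>X. if Max (Poly_Mapping.keys u) = Suc i then 1 else 0)"
    by (auto simp: maxgen_def lookup_sum last_var_def expo_xpow intro!: sum.cong)
  also have "\<dots> = card {u \<in> X. Max (Poly_Mapping.keys u) = Suc i}"
    using fin by (simp add: sum.If_cases Int_def)
  also have "{u \<in> X. Max (Poly_Mapping.keys u) = Suc i} = X \<inter> mons (Suc i) - X \<inter> mons i"
    using iff by (auto simp: le_Suc_eq)
  also have "card \<dots> = card (X \<inter> mons (Suc i)) - card (X \<inter> mons i)"
    using mons_mono[of i "Suc i"] fin by (intro card_Diff_subset) auto
  finally show ?thesis
    using mons_mono[of i "Suc i"] fin card_mono[of "X \<inter> mons (Suc i)" "X \<inter> mons i"]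
    by (simp add: le_infI2)
qed

text \<open>By \<open>expo_maxgen\<close> the counts are cumulative sums of the exponents, starting
  from zero.\<close>

lemma maxgen_eq_iff:
  assumes X: "X \<subseteq> mons_deg n d" "0 \<notin> X" and Y: "Y \<subseteq> mons_deg n d" "0 \<notin> Y"
  shows "(\<forall>i\<in>{1..m}. expo (maxgen X) i = expo (maxgen Y) i) \<longleftrightarrow>
    (\<forall>i\<in>{1..m}. card (X \<inter> mons i) = card (Y \<inter> mons i))"
proof
  assume r: "\<forall>i\<in>{1..m}. card (X \<inter> mons i) = card (Y \<inter> mons i)"
  have e: "card (X \<inter> mons i) = card (Y \<inter> mons i)" if "i \<le> m" for i
    using r that X(2) Y(2) by (cases i) (auto simp: mons_0_eq)
  have "expo (maxgen X) (Suc i) = expo (maxgen Y) (Suc i)" if "Suc i \<le> m" for i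
    using expo_maxgen[OF X, of i] expo_maxgen[OF Y, of i] e[of i] e[of "Suc i"] that by simp
  then show "\<forall>i\<in>{1..m}. expo (maxgen X) i = expo (maxgen Y) i"
    by (metis Suc_le_D atLeastAtMost_iff One_nat_def)
next
  assume r: "\<forall>i\<in>{1..m}. expo (maxgen X) i = expo (maxgen Y) i"
  have "card (X \<inter> mons i) = card (Y \<inter> mons i)" if "i \<le> m" for i
    using that
  proof (induction i)
    case 0
    then show ?case using X(2) Y(2) by (auto simp: mons_0_eq)
  next
    case (Suc i)
    have "expo (maxgen X) (Suc i) = expo (maxgen Y) (Suc i)" using r Suc.prems by simp
    then show ?case using expo_maxgen[OF X, of i] expo_maxgen[OF Y, of i] Suc by simp
  qed
  then show "\<forall>i\<in>{1..m}. card (X \<inter> mons i) = card (Y \<inter> mons i)" by simp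
qed

lemma expo_proj: "expo (proj m u) i = (if i \<in> {1..m} then expo u i else 0)"
  by (simp add: proj_def lookup_sum expo_xpow)

lemma proj_eq_iff: "proj m u = proj m v \<longleftrightarrow> (\<forall>i\<in>{1..m}. expo u i = expo v i)"
  unfolding poly_mapping_eq_iff fun_eq_iff expo_proj by auto

lemma finite_lex_ge: "finite (lex_ge n u)"
  using finite_subset[OF lex_ge_subset finite_mons_deg] .

lemma lex_between_eq: "v \<in> lex_ge n u \<Longrightarrow> lex_between n v u = lex_ge n u - lex_ge n v"
  by (auto simp: lex_between_def lex_ge_def mons_deg_def)

lemma lex_ge_antimono: "v \<in> lex_ge n u \<Longrightarrow> lex_ge n v \<subseteq> lex_ge n u"
  by (auto simp: lex_ge_def mons_deg_def)

lemma zero_notin_gaps: "0 \<notin> gaps n u"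
proof
  assume "0 \<in> gaps n u"
  then have "mdeg u = 0" "0 \<notin> borel_set u"
    by (auto simp: gaps_def lex_ge_iff mdeg_eq_0_iff) (metis mdeg_eq_0_iff)
  then show False using borel_set.base[of u] by (simp add: mdeg_eq_0_iff)
qed

lemma zero_notin_lex_between: "v \<in> lex_ge n u \<Longrightarrow> 0 \<notin> lex_between n v u"
proof
  assume v: "v \<in> lex_ge n u" and "0 \<in> lex_between n v u"
  then have "mdeg v = mdeg 0" "0 < v" by (auto simp: lex_ge_def lex_between_def mons_deg_def)
  then show False using mdeg_eq_0_iff[of v] mdeg_eq_0_iff[of 0] by simp
qed

lemma card_Diff_Int:
  assumes "finite L" "A \<subseteq> L"
  shows "card ((L - A) \<inter> M) + card (A \<inter> M) = card (L \<inter> M)"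
proof -
  have "L \<inter> M = ((L - A) \<inter> M) \<union> (A \<inter> M)" using assms(2) by auto
  moreover have "finite ((L - A) \<inter> M)" "finite (A \<inter> M)" using assms finite_subset by auto
  ultimately show ?thesis using card_Un_disjoint[of "(L - A) \<inter> M" "A \<inter> M"] by (simp add: disjoint_iff)
qed

lemma gaps_subset: "gaps n u \<subseteq> mons_deg n (mdeg u)"
  using lex_ge_subset by (auto simp: gaps_def)

lemma lex_between_subset: "lex_between n v u \<subseteq> mons_deg n (mdeg u)"
  by (auto simp: lex_between_def)

text \<open>Together with \<open>card_lex_between\<close> this compares gaps and intervals through
  their complements in the same segment \<open>lex_ge n u\<close>; the additive form avoids
  truncated subtraction.\<close>

lemma card_gaps:
  assumes "u \<in> mons n"
  shows "card (gaps n u \<inter> M) + card (borel_set u \<inter> M) = card (lex_ge n u \<inter> M)"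
  unfolding gaps_def by (rule card_Diff_Int[OF finite_lex_ge borel_set_subset_lex_ge[OF assms]])

lemma card_lex_between:
  assumes "v \<in> lex_ge n u"
  shows "card (lex_between n v u \<inter> M) + card (lex_ge n v \<inter> M) = card (lex_ge n u \<inter> M)"
  unfolding lex_between_eq[OF assms] by (rule card_Diff_Int[OF finite_lex_ge lex_ge_antimono[OF assms]])

section \<open>Passing from \<open>n\<close> to \<open>n + 1\<close> variables\<close>

lemma xpow_mono: "i \<le> j \<Longrightarrow> xpow j c \<le> xpow i c"
  by (cases "i = j"; cases "c = 0") (auto simp: mon_less_iff expo_xpow intro!: less_imp_le exI[of _ i])

text \<open>A monomial free of x_{m+1} has full degree at index \<open>m\<close>, so dominance is
  decided below \<open>m\<close>, where neither x_{m+1}^t nor x_m^t contributes.\<close>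

lemma borel_set_Int_mons:
  assumes u: "u \<in> mons m" and m: "1 \<le> m"
  shows "borel_set (u + xpow (Suc m) t) \<inter> mons m = borel_set (u + xpow m t)"
proof (rule Set.set_eqI)
  fix v
  have um: "u + xpow m t \<in> mons m" using u m by (simp add: mons_add_iff xpow_in_mons)
  have uS: "u + xpow (Suc m) t \<in> mons (Suc m)"
    using u mons_mono[of m "Suc m"] by (auto simp: mons_add_iff xpow_in_mons)
  have d: "mdeg (u + xpow (Suc m) t) = mdeg u + t" "mdeg (u + xpow m t) = mdeg u + t"
    by (simp_all add: mdeg_add mdeg_xpow)
  have "msum (u + xpow (Suc m) t) i \<le> msum v i \<longleftrightarrow> msum (u + xpow m t) i \<le> msum v i"
    if v: "v \<in> mons m" "mdeg v = mdeg u + t" for i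
  proof (cases "i < m")
    case True
    then show ?thesis by (simp add: msum_add msum_xpow)
  next
    case False
    have "msum (u + xpow (Suc m) t) i \<le> msum (u + xpow (Suc m) t) (max i (Suc m))" by (rule msum_mono) simp
    then show ?thesis
      using False msum_mdeg[OF v(1), of i] msum_mdeg[OF um, of i] msum_mdeg[OF uS, of "max i (Suc m)"] v(2) d by auto
  qed
  then show "v \<in> borel_set (u + xpow (Suc m) t) \<inter> mons m \<longleftrightarrow> v \<in> borel_set (u + xpow m t)"
    using mons_mono[of m "Suc m"] by (auto simp: borel_set_iff[OF um] borel_set_iff[OF uS] d)
qed

text \<open>If \<open>y\<close> were below \<open>w + xpow m b\<close>, the first difference would
  occur before \<open>m\<close>, where x_m^b and x_{m+1}^b look alike.\<close>

lemma mons_ge_xpow: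
  assumes "w \<in> mons m" "y \<in> mons m" "mdeg y = mdeg w + b" "w + xpow (Suc m) b \<le> y" "1 \<le> m"
  shows "w + xpow m b \<le> y"
proof (rule ccontr)
  assume "\<not> w + xpow m b \<le> y"
  then obtain k where k: "expo y k < expo (w + xpow m b) k" "\<And>i. i < k \<Longrightarrow> expo y i = expo (w + xpow m b) i"
    by (auto simp: mon_less_iff not_le)
  have "k < m"
  proof (rule ccontr)
    assume "\<not> k < m"
    then have "y = w + xpow m b"
      using assms k(2) by (intro mons_deg_eqI[of _ m]) (auto simp: mons_add_iff xpow_in_mons mdeg_add mdeg_xpow)
    with k show False by simp
  qed
  then have "y < w + xpow (Suc m) b"
    using k by (auto simp: mon_less_iff lookup_add expo_xpow intro!: exI[of _ k])
  with assms(4) show False by simp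
qed

text \<open>
  Among the monomials in \<open>m + 1\<close> variables of the degree of \<open>z \<in> mons m\<close>, this is the smallest one
  that exceeds every element of \<open>mons m\<close> below \<open>z\<close>.
\<close>

definition corner :: "nat \<Rightarrow> mon \<Rightarrow> mon" where
  "corner m z = z - xpow m (expo z m) + xpow (Suc m) (expo z m)"

lemma corner_split:
  obtains w where "z = w + xpow m (expo z m)" "expo w m = 0" "corner m z = w + xpow (Suc m) (expo z m)"
proof (rule expo_ge_split[of "expo z m" z m])
  fix w assume w: "z = w + xpow m (expo z m)" "expo w m = expo z m - expo z m"
  have "z - xpow m (expo z m) = w" using w(1) by (metis add_diff_cancel_right')
  then show thesis using that w by (simp add: corner_def)
qed simp

lemma corner_add: "corner m (z + xpow m t) = corner m z + xpow (Suc m) t"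
proof -
  obtain w where w: "z = w + xpow m (expo z m)" "corner m z = w + xpow (Suc m) (expo z m)"
    using corner_split by metis
  have e: "expo (z + xpow m t) m = expo z m + t" by (simp add: lookup_add)
  have "z + xpow m t = w + xpow m (expo z m + t)"
    using w(1) by (metis add.assoc single_add)
  then have "z + xpow m t - xpow m (expo z m + t) = w" by simp
  then show ?thesis using w(2) e by (simp add: corner_def single_add add.assoc)
qed

lemma corner_le: "corner m z \<le> z"
proof -
  obtain w where "z = w + xpow m (expo z m)" "corner m z = w + xpow (Suc m) (expo z m)"
    using corner_split by metis
  then show ?thesis
    using add_left_mono[OF xpow_mono[of m "Suc m" "expo z m"], of w] by simp
qed

lemma corner_mons:
  assumes "z \<in> mons m" "1 \<le> m"
  shows "corner m z \<in> mons (Suc m)" "mdeg (corner m z) = mdeg z"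
proof -
  obtain w where w: "z = w + xpow m (expo z m)" "corner m z = w + xpow (Suc m) (expo z m)"
    using corner_split by metis
  have "w \<in> mons m" using assms w(1) mons_add_iff by metis
  then show "corner m z \<in> mons (Suc m)"
    using w(2) mons_mono[of m "Suc m"] by (auto simp: mons_add_iff xpow_in_mons)
  show "mdeg (corner m z) = mdeg z" using w by (metis mdeg_add mdeg_xpow)
qed

lemma corner_ge_mons:
  assumes "z \<in> mons m" "y \<in> mons m" "mdeg y = mdeg z" "corner m z \<le> y" "1 \<le> m"
  shows "z \<le> y"
proof -
  obtain w where w: "z = w + xpow m (expo z m)" "corner m z = w + xpow (Suc m) (expo z m)"
    using corner_split by metis
  have "w \<in> mons m" using assms(1) w(1) mons_add_iff by metis
  moreover have "mdeg y = mdeg w + expo z m" using assms(3) w(1) by (metis mdeg_add mdeg_xpow)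
  ultimately have "w + xpow m (expo z m) \<le> y" using mons_ge_xpow assms w(2) by metis
  then show ?thesis using w(1) by simp
qed

section \<open>Segments with a prescribed part in fewer variables\<close>

lemma lex_ge_Int_mons_iff:
  assumes z: "z \<in> mons m" and v: "v \<in> mons (Suc m)" "mdeg v = mdeg z" and m: "1 \<le> m"
  shows "lex_ge (Suc m) v \<inter> mons m = lex_ge m z \<longleftrightarrow> corner m z \<le> v \<and> v \<le> z"
proof
  assume r: "corner m z \<le> v \<and> v \<le> z"
  show "lex_ge (Suc m) v \<inter> mons m = lex_ge m z"
  proof (rule Set.set_eqI)
    fix y show "y \<in> lex_ge (Suc m) v \<inter> mons m \<longleftrightarrow> y \<in> lex_ge m z"
      using r v corner_ge_mons[OF z, of y] m mons_mono[of m "Suc m"] by (auto simp: lex_ge_iff)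
  qed
next
  assume eq: "lex_ge (Suc m) v \<inter> mons m = lex_ge m z"
  have "z \<in> lex_ge m z" using z by (simp add: lex_ge_iff)
  then have "v \<le> z" using eq by (metis Int_iff lex_ge_iff)
  moreover have "corner m z \<le> v"
  proof (rule ccontr)
    assume "\<not> corner m z \<le> v"
    then obtain k where k: "expo v k < expo (corner m z) k" "\<And>i. i < k \<Longrightarrow> expo v i = expo (corner m z) i"
      by (auto simp: mon_less_iff not_le)
    obtain w where w: "z = w + xpow m (expo z m)" "expo w m = 0" "corner m z = w + xpow (Suc m) (expo z m)"
      by (rule corner_split)
    have wz: "expo w i = expo z i" if "i < m" for i
      using that arg_cong[OF w(1), of "\<lambda>u. expo u i"] by (simp add: lookup_add expo_xpow)
    have "\<not> Suc m \<le> k"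
    proof
      assume "Suc m \<le> k"
      then have "v = corner m z"
        using v corner_mons[OF z m] k(2) by (intro mons_deg_eqI[of _ "Suc m"]) auto
      with k show False by simp
    qed
    \<comment> \<open>The corner has exponent zero at \<open>m\<close>, and no exponent is
      smaller.\<close>
    moreover have "k \<noteq> m" using k(1) w(2,3) by (auto simp: lookup_add expo_xpow)
    ultimately have km: "k < m" by simp
    define c where "c = expo v (Suc m)"
    obtain x where x: "v = x + xpow (Suc m) c" "expo x (Suc m) = 0"
      using expo_ge_split[of c v "Suc m"] by (auto simp: c_def)
    have xS: "x \<in> mons (Suc m)" using v(1) x(1) mons_add_iff by metis
    have "expo x i = 0" if "m < i" for i
      using xS x(2) that by (cases "i = Suc m") (auto simp: mons_iff)
    then have "x \<in> mons m" using xS by (auto simp: mons_iff)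
    \<comment> \<open>Turning the power of x_{m+1} in \<open>v\<close> into one of x_m gives an
      element of \<open>mons m\<close> that is at least \<open>v\<close>, yet below
      \<open>z\<close>, since \<open>v\<close> drops below \<open>z\<close> before index
      \<open>m\<close>.\<close>
    then have y: "x + xpow m c \<in> lex_ge (Suc m) v \<inter> mons m"
      using x(1) v m xS xpow_mono[of m "Suc m" c] mons_mono[of m "Suc m"]
      by (auto simp: lex_ge_iff mons_add_iff xpow_in_mons mdeg_add mdeg_xpow)
    have "x + xpow m c < z"
      unfolding mon_less_iff using k km w x(1) wz
      by (intro exI[of _ k]) (auto simp: lookup_add expo_xpow)
    then have "x + xpow m c \<notin> lex_ge m z" by (simp add: lex_ge_iff not_le)
    then show False using y eq by simp
  qed
  ultimately show "corner m z \<le> v \<and> v \<le> z" by simp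
qed

text \<open>\<open>w + xvar m\<close> is the immediate successor of \<open>w + xvar (Suc m)\<close>
  among monomials of that degree in \<open>mons (Suc m)\<close>.\<close>

lemma lex_ge_insert:
  assumes w: "w \<in> mons (Suc m)" and m: "1 \<le> m"
  shows "lex_ge (Suc m) (w + xvar (Suc m)) = insert (w + xvar (Suc m)) (lex_ge (Suc m) (w + xvar m))"
proof
  have less: "w + xvar (Suc m) \<le> w + xvar m" using xvar_mono[of m "Suc m"] by (intro add_left_mono) simp
  show "insert (w + xvar (Suc m)) (lex_ge (Suc m) (w + xvar m)) \<subseteq> lex_ge (Suc m) (w + xvar (Suc m))"
    using order_trans[OF less] w by (auto simp: lex_ge_iff mons_add_iff xvar_in_mons_iff mdeg_add mdeg_xpow)
  show "lex_ge (Suc m) (w + xvar (Suc m)) \<subseteq> insert (w + xvar (Suc m)) (lex_ge (Suc m) (w + xvar m))"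
  proof
    fix y assume "y \<in> lex_ge (Suc m) (w + xvar (Suc m))"
    then have y: "y \<in> mons (Suc m)" "mdeg y = mdeg w + 1" "w + xvar (Suc m) \<le> y"
      by (auto simp: lex_ge_iff mdeg_add mdeg_xpow)
    have "w + xvar m \<le> y" if ne: "y \<noteq> w + xvar (Suc m)"
    proof (rule ccontr)
      assume "\<not> w + xvar m \<le> y"
      then obtain k where k: "expo y k < expo (w + xvar m) k" "\<And>i. i < k \<Longrightarrow> expo y i = expo (w + xvar m) i"
        by (auto simp: mon_less_iff not_le)
      have km: "k \<le> m"
      proof (rule ccontr)
        assume "\<not> k \<le> m"
        then have "y = w + xvar m"
          using y w m k(2) by (intro mons_deg_eqI[of _ "Suc m"]) (auto simp: mons_add_iff xvar_in_mons_iff mdeg_add mdeg_xpow)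
        with k show False by simp
      qed
      have "expo y k \<ge> expo (w + xvar (Suc m)) k"
      proof (rule ccontr)
        assume "\<not> ?thesis"
        then have "y < w + xvar (Suc m)"
          using k km by (auto simp: mon_less_iff lookup_add expo_xpow intro!: exI[of _ k])
        with y(3) show False by simp
      qed
      \<comment> \<open>The two bounds for \<open>y\<close> agree below \<open>m\<close> and differ
        by one at \<open>m\<close>.\<close>
      then have "k = m" "expo y m = expo (w + xvar (Suc m)) m"
        using k(1) km by (auto simp: lookup_add expo_xpow split: if_splits)
      then have "expo y i = expo (w + xvar (Suc m)) i" if "i < Suc m" for i
        using that k(2)[of i] by (cases "i = m") (auto simp: lookup_add expo_xpow)
      then have "y = w + xvar (Suc m)"
        using y w by (intro mons_deg_eqI[of _ "Suc m"]) (auto simp: mons_add_iff xvar_in_mons_iff mdeg_add mdeg_xpow)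
      with ne show False by simp
    qed
    then show "y \<in> insert (w + xvar (Suc m)) (lex_ge (Suc m) (w + xvar m))"
      using y w m by (auto simp: lex_ge_iff mdeg_add mdeg_xpow)
  qed
qed

text \<open>Induction on the exponent of x_{m+1}: exchanging one factor x_{m+1} for x_m removes
  exactly one monomial from the segment, and exponent zero leaves only \<open>z\<close>.\<close>

lemma card_lex_ge_corner:
  assumes z: "z \<in> mons m" and m: "1 \<le> m"
  shows "v \<in> mons (Suc m) \<Longrightarrow> mdeg v = mdeg z \<Longrightarrow> corner m z \<le> v \<Longrightarrow> v \<le> z \<Longrightarrow>
    card (lex_ge (Suc m) v) = card (lex_ge (Suc m) z) + expo v (Suc m)"
proof (induction "expo v (Suc m)" arbitrary: v)
  case 0
  have "expo v i = 0" if "m < i" for i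
    using 0 that by (cases "i = Suc m") (auto simp: mons_iff)
  then have "v \<in> mons m" using 0(2) by (auto simp: mons_iff)
  then have "v = z" using corner_ge_mons[OF z, of v] 0 m by auto
  then show ?case using 0 by simp
next
  case (Suc c)
  then obtain w where w: "v = w + xvar (Suc m)" using expo_pos_split[of v "Suc m"] by auto
  have wm: "w \<in> mons (Suc m)" using Suc.prems(1) w mons_add_iff by metis
  let ?v = "w + xvar m"
  have vd: "?v \<in> mons (Suc m)" "mdeg ?v = mdeg z"
    using wm m Suc.prems(2) w by (auto simp: mons_add_iff xvar_in_mons_iff mdeg_add mdeg_xpow)
  have less: "v \<noteq> ?v" "v \<le> ?v" using w xvar_mono[of m "Suc m"]
    by (auto intro!: add_left_mono dest: arg_cong[where f = "\<lambda>u. expo u m"] simp: expo_xpow)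
  have ins: "lex_ge (Suc m) v = insert v (lex_ge (Suc m) ?v)" using lex_ge_insert[OF wm m] w by simp
  have "z \<noteq> v" using z Suc.hyps(2) by (auto simp: mons_iff)
  moreover have "z \<in> lex_ge (Suc m) v" using Suc.prems z mons_mono[of m "Suc m"] by (auto simp: lex_ge_iff)
  ultimately have "z \<in> lex_ge (Suc m) ?v" using ins by auto
  then have vz: "?v \<le> z" by (simp add: lex_ge_iff)
  have c: "c = expo ?v (Suc m)" using Suc.hyps(2) w by (simp add: lookup_add expo_xpow)
  have "card (lex_ge (Suc m) ?v) = card (lex_ge (Suc m) z) + expo ?v (Suc m)"
    using Suc.hyps(1)[OF c vd] Suc.prems(3) less(2) vz by auto
  moreover have "v \<notin> lex_ge (Suc m) ?v" using less by (auto simp: lex_ge_iff)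
  ultimately show ?case using ins finite_lex_ge[of "Suc m" ?v] c Suc.hyps(2) by simp
qed

text \<open>The count at \<open>i = m\<close> forces \<open>lex_ge (Suc m) v \<inter> mons m\<close>
  to be the segment of \<open>z\<close>, because size determines a segment;
  \<open>lex_ge_Int_mons_iff\<close> turns this into an interval.\<close>

lemma lex_match_Int_mons:
  assumes u: "u0 \<in> mons m" and m: "1 \<le> m"
    and z: "lex_match m (u0 + xpow m t) z"
    and v: "v \<in> mons (Suc m)" "mdeg v = mdeg u0 + t"
  shows "(\<forall>i\<in>{1..m}. card (borel_set (u0 + xpow (Suc m) t) \<inter> mons i) = card (lex_ge (Suc m) v \<inter> mons i))
    \<longleftrightarrow> corner m z \<le> v \<and> v \<le> z"
proof -
  let ?B = "borel_set (u0 + xpow (Suc m) t)"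
  have um: "u0 + xpow m t \<in> mons m" using u m by (simp add: mons_add_iff xpow_in_mons)
  have zm: "z \<in> mons m" "mdeg z = mdeg u0 + t"
    using z by (auto simp: lex_match_def lex_ge_iff mdeg_add mdeg_xpow)
  have B: "?B \<inter> mons m = borel_set (u0 + xpow m t)" by (rule borel_set_Int_mons[OF u m])
  have Int: "A \<inter> mons i = A \<inter> mons m \<inter> mons i" if "i \<in> {1..m}" for A i
    using that mons_mono[of i m] by auto
  have "lex_ge (Suc m) v \<inter> mons m = lex_ge m z \<longleftrightarrow>
    (\<forall>i\<in>{1..m}. card (?B \<inter> mons i) = card (lex_ge (Suc m) v \<inter> mons i))"
  proof
    assume eq: "lex_ge (Suc m) v \<inter> mons m = lex_ge m z"
    have "card (?B \<inter> mons i) = card (lex_ge (Suc m) v \<inter> mons i)" if i: "i \<in> {1..m}" for i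
      unfolding Int[OF i, of ?B] Int[OF i, of "lex_ge (Suc m) v"] B eq
      using z i by (simp add: lex_match_def)
    then show "\<forall>i\<in>{1..m}. card (?B \<inter> mons i) = card (lex_ge (Suc m) v \<inter> mons i)" by blast
  next
    assume "\<forall>i\<in>{1..m}. card (?B \<inter> mons i) = card (lex_ge (Suc m) v \<inter> mons i)"
    then have "card (?B \<inter> mons m) = card (lex_ge (Suc m) v \<inter> mons m)" using m by simp
    then have "card (lex_ge (Suc m) v \<inter> mons m) = card (lex_ge m z)"
      using B lex_match_card[OF z um m] by simp
    moreover have "lexseg m (mdeg z) (lex_ge (Suc m) v \<inter> mons m)"
      using lexseg_Int_mons[OF lexseg_lex_ge[of "Suc m" v], of m] v zm by simp
    ultimately show "lex_ge (Suc m) v \<inter> mons m = lex_ge m z"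
      using lexseg_unique lexseg_lex_ge by blast
  qed
  then show ?thesis using lex_ge_Int_mons_iff[OF zm(1) v(1) _ m] v zm by simp
qed

text \<open>The part of the matching segment in \<open>mons m\<close> is again a segment, with the
  right counts by \<open>borel_set_Int_mons\<close>; its least element is the match in
  \<open>m\<close> variables.\<close>

lemma lex_match_down:
  assumes u: "u0 \<in> mons m" and m: "1 \<le> m" and v: "lex_match (Suc m) (u0 + xpow (Suc m) t) v"
  shows "\<exists>z. lex_match m (u0 + xpow m t) z"
proof -
  let ?B = "borel_set (u0 + xpow (Suc m) t)" and ?L = "lex_ge (Suc m) v \<inter> mons m"
  have um: "u0 + xpow m t \<in> mons m" using u m by (simp add: mons_add_iff xpow_in_mons)
  have vS: "v \<in> mons (Suc m)" "mdeg v = mdeg u0 + t" "u0 + xpow (Suc m) t \<le> v"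
    using v by (auto simp: lex_match_def lex_ge_iff mdeg_add mdeg_xpow)
  have B: "?B \<inter> mons m = borel_set (u0 + xpow m t)" by (rule borel_set_Int_mons[OF u m])
  have Int: "A \<inter> mons i = A \<inter> mons m \<inter> mons i" if "i \<in> {1..m}" for A i
    using that mons_mono[of i m] by auto
  have eq: "card (borel_set (u0 + xpow m t) \<inter> mons i) = card (?L \<inter> mons i)" if i: "i \<in> {1..m}" for i
    using v i unfolding B[symmetric] Int[OF i, symmetric] by (simp add: lex_match_def)
  have L: "lexseg m (mdeg u0 + t) ?L"
    using lexseg_Int_mons[OF lexseg_lex_ge[of "Suc m" v], of m] vS by simp
  have "u0 + xpow m t \<in> borel_set (u0 + xpow m t) \<inter> mons m" using um borel_set.base by blast
  moreover have "finite (borel_set (u0 + xpow m t) \<inter> mons m)"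
    using finite_subset[OF borel_set_subset[OF um] finite_mons_deg] by simp
  ultimately have "card (borel_set (u0 + xpow m t) \<inter> mons m) \<noteq> 0" by auto
  then have "card (?L \<inter> mons m) \<noteq> 0" using eq[of m] m by simp
  then have "?L \<noteq> {}" by (metis card.empty inf_bot_left)
  then obtain z where z: "z \<in> ?L" "z \<in> mons m" "mdeg z = mdeg u0 + t" "?L = lex_ge m z"
    using lexseg_eq_lex_ge[OF L] by metis
  have "v \<le> z" using z(1) by (simp add: lex_ge_iff)
  then have "u0 + xpow m t \<le> z" using mons_ge_xpow[OF u z(2,3)] vS(3) m by simp
  then have "lex_match m (u0 + xpow m t) z"
    using eq z by (simp add: lex_match_def lex_ge_iff mdeg_add mdeg_xpow)
  then show ?thesis by blast
qed

text \<open>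
  The monomials \<open>v\<close> with the prescribed exponents of \<open>x\<^sub>1, \<dots>, x\<^sub>m\<close> in \<open>\<mu>(u, v)\<close> form the interval from
  \<open>max u (corner m z)\<close> to \<open>z\<close>, along which the last exponent of \<open>v\<close> decreases in steps of one.
\<close>

lemma step_up:
  assumes u0: "u0 \<in> mons m" and m: "1 \<le> m"
    and z: "lex_match m (u0 + xpow m t) z"
  defines "u \<equiv> u0 + xpow (Suc m) t"
  defines "b \<equiv> max u (corner m z)"
  shows step_up_z: "z_mon (Suc m) u0 t = b"
    and step_up_le: "card (borel_set u) \<le> card (lex_ge (Suc m) b)"
    and step_up_f: "f_val (Suc m) u0 t + card (borel_set u) = h_val (Suc m) u0 t + card (lex_ge (Suc m) b)"
    and step_up_iff: "(\<exists>v. lex_match (Suc m) u v) \<longleftrightarrow> card (lex_ge (Suc m) b) \<le> card (borel_set u) + k_val (Suc m) u0 t"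
    and step_up_Int: "card (lex_ge (Suc m) b \<inter> mons m) = card (borel_set u \<inter> mons m)"
    and step_up_mons: "b \<in> mons (Suc m)"
    and step_up_card: "card (lex_ge (Suc m) b) = card (lex_ge (Suc m) z) + k_val (Suc m) u0 t"
proof -
  let ?N = "Suc m" and ?e = "mdeg u0 + t"
  have u: "u \<in> mons ?N" "mdeg u = ?e"
    using u0 mons_mono[of m ?N] by (auto simp: u_def mons_add_iff xpow_in_mons mdeg_add mdeg_xpow)
  have zm: "z \<in> mons m" "mdeg z = ?e" "u0 + xpow m t \<le> z"
    using z by (auto simp: lex_match_def lex_ge_iff mdeg_add mdeg_xpow)
  have zN: "z \<in> mons ?N" using zm(1) mons_mono[of m ?N] by auto
  have "u \<le> u0 + xpow m t" unfolding u_def by (intro add_left_mono xpow_mono) simp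
  then have uz: "u \<le> z" using zm(3) by (rule order_trans)
  have b: "b \<in> mons ?N" "mdeg b = ?e" "u \<le> b" "corner m z \<le> b" "b \<le> z"
    using u corner_mons[OF zm(1) m] zm(2) uz corner_le[of m z] by (auto simp: b_def max_def)
  show "b \<in> mons ?N" by (rule b(1))
  have interval: "(\<forall>i\<in>{1..m}. card (borel_set u \<inter> mons i) = card (lex_ge ?N v \<inter> mons i))
      \<longleftrightarrow> b \<le> v \<and> v \<le> z" if "v \<in> lex_ge ?N u" for v
    using lex_match_Int_mons[OF u0 m z, of v] that u by (auto simp: u_def[symmetric] lex_ge_iff b_def)
  have bu: "b \<in> lex_ge ?N u" using b u by (simp add: lex_ge_iff)
  \<comment> \<open>Equal exponents mean equal counts for gaps and interval, hence for their
    complements in \<open>lex_ge ?N u\<close>, the Borel set and \<open>lex_ge ?N v\<close>.\<close>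
  have proj: "proj m (mu ?N u v) = w_mon ?N u0 t \<longleftrightarrow> b \<le> v \<and> v \<le> z" if v: "v \<in> lex_ge ?N u" for v
  proof -
    have "proj m (mu ?N u v) = w_mon ?N u0 t \<longleftrightarrow>
        (\<forall>i\<in>{1..m}. card (lex_between ?N v u \<inter> mons i) = card (gaps ?N u \<inter> mons i))"
      unfolding w_mon_def mg_def mu_def u_def[symmetric] diff_Suc_1 proj_eq_iff
      by (rule maxgen_eq_iff[OF lex_between_subset zero_notin_lex_between[OF v] gaps_subset zero_notin_gaps])
    also have "\<dots> \<longleftrightarrow> (\<forall>i\<in>{1..m}. card (borel_set u \<inter> mons i) = card (lex_ge ?N v \<inter> mons i))"
    proof (intro ball_cong refl)
      fix i
      show "card (lex_between ?N v u \<inter> mons i) = card (gaps ?N u \<inter> mons i) \<longleftrightarrow>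
          card (borel_set u \<inter> mons i) = card (lex_ge ?N v \<inter> mons i)"
        using card_gaps[OF u(1), of "mons i"] card_lex_between[OF v, of "mons i"] by linarith
    qed
    finally show ?thesis using interval[OF v] by simp
  qed
  show zb: "z_mon ?N u0 t = b"
    unfolding z_mon_def u_def[symmetric] diff_Suc_1
    by (rule Least_equality) (use bu proj b in auto)
  have kb: "k_val ?N u0 t = expo b ?N" by (simp add: k_val_def zb)
  show card_b: "card (lex_ge ?N b) = card (lex_ge ?N z) + k_val ?N u0 t"
    unfolding kb using b zm by (intro card_lex_ge_corner[OF zm(1) m]) auto
  have Int: "\<forall>i\<in>{1..m}. card (borel_set u \<inter> mons i) = card (lex_ge ?N b \<inter> mons i)"
    using interval[OF bu] b by simp
  then show Int_m: "card (lex_ge ?N b \<inter> mons m) = card (borel_set u \<inter> mons m)" using m by simp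
  have all: "A \<inter> mons ?N = A" if "A \<subseteq> mons_deg ?N (mdeg u)" for A
    using that by (rule Int_mons_all)
  have lex_all: "lex_ge ?N v \<inter> mons ?N = lex_ge ?N v" for v
    by (rule Int_mons_all[OF lex_ge_subset])
  \<comment> \<open>Exponents of the last variable count elements outside \<open>mons m\<close>; the
    counts inside \<open>mons m\<close> agree for gaps and interval and cancel.\<close>
  show "f_val ?N u0 t + card (borel_set u) = h_val ?N u0 t + card (lex_ge ?N b)"
  proof -
    have "f_val ?N u0 t + card (gaps ?N u \<inter> mons m) = card (gaps ?N u)"
      using expo_maxgen[OF gaps_subset zero_notin_gaps, of ?N u m]
      unfolding all[OF gaps_subset] by (simp add: f_val_def mg_def u_def)
    moreover have "h_val ?N u0 t + card (lex_between ?N b u \<inter> mons m) = card (lex_between ?N b u)"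
      using expo_maxgen[OF lex_between_subset zero_notin_lex_between[OF bu], of m]
      unfolding all[OF lex_between_subset] by (simp add: h_val_def mu_def zb u_def)
    moreover have "card (gaps ?N u) + card (borel_set u) = card (lex_ge ?N u)"
      using card_gaps[OF u(1), of UNIV] by simp
    moreover have "card (lex_between ?N b u) + card (lex_ge ?N b) = card (lex_ge ?N u)"
      using card_lex_between[OF bu, of UNIV] by simp
    ultimately show ?thesis
      using card_gaps[OF u(1), of "mons m"] card_lex_between[OF bu, of "mons m"] Int_m by linarith
  qed
  have Bsub: "borel_set u \<subseteq> mons_deg ?N ?e" using borel_set_subset[OF u(1)] u(2) by simp
  have B_le: "card (borel_set u) \<le> card (lex_ge ?N u)"
    by (intro card_mono finite_lex_ge borel_set_subset_lex_ge[OF u(1)])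
  have seg: "lexseg ?N ?e (lex_ge ?N v)" if "mdeg v = ?e" for v using lexseg_lex_ge[of ?N v] that by simp
  have "card (borel_set u) \<le> card (mons_deg ?N ?e)" by (intro card_mono finite_mons_deg Bsub)
  then obtain L where L: "lexseg ?N ?e L" "card L = card (borel_set u)" by (rule lexseg_exists)
  have "finite (borel_set u)" using finite_subset[OF Bsub finite_mons_deg] .
  then have "card L \<noteq> 0" using L(2) borel_set.base[of u] by auto
  then have "L \<noteq> {}" by auto
  then obtain v where v: "v \<in> L" "v \<in> mons ?N" "mdeg v = ?e" "L = lex_ge ?N v"
    using lexseg_eq_lex_ge[OF L(1)] by metis
  have "L \<subseteq> lex_ge ?N u" using lexseg_subset[OF L(1) seg[OF u(2)]] L(2) B_le by simp
  then have vu: "v \<in> lex_ge ?N u" using v(1) by blast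
  have mem: "x \<in> lex_ge ?N x" if "x \<in> mons ?N" for x using that by (simp add: lex_ge_iff)
  show card_B_le: "card (borel_set u) \<le> card (lex_ge ?N b)"
  proof (rule ccontr)
    assume "\<not> ?thesis"
    then have less: "card (lex_ge ?N b) < card L" using L(2) by simp
    have bL: "lex_ge ?N b \<subseteq> L" using lexseg_subset[OF seg[OF b(2)] L(1)] less by simp
    \<comment> \<open>By Macaulay's inequality the longer segment \<open>L\<close> gains nothing in
      \<open>mons m\<close>, so its least element \<open>v\<close> is still at least
      \<open>b\<close>, which contradicts its size.\<close>
    have "card (L \<inter> mons m) \<le> card (borel_set u \<inter> mons m)"
      using L(2) by (intro card_lexseg_Int_mons_le[OF Bsub borel_set_stable L(1)]) simp
    then have "L \<inter> mons m = lex_ge ?N b \<inter> mons m"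
      using Int_m bL lexseg_finite[OF L(1)] card_seteq[of "L \<inter> mons m" "lex_ge ?N b \<inter> mons m"] by auto
    moreover have "lex_ge ?N b \<inter> mons m = lex_ge m z"
      using b zm by (subst lex_ge_Int_mons_iff[OF zm(1) b(1) _ m]) auto
    ultimately have "corner m z \<le> v"
      using lex_ge_Int_mons_iff[OF zm(1) v(2) _ m] v(3,4) zm(2) by auto
    then have "b \<le> v" using vu by (auto simp: b_def lex_ge_iff)
    then have "v \<in> lex_ge ?N b" using v b by (simp add: lex_ge_iff)
    then have "L \<subseteq> lex_ge ?N b" using v(4) lex_ge_antimono by blast
    then have "card L \<le> card (lex_ge ?N b)" by (intro card_mono finite_lex_ge)
    with less show False by simp
  qed
  show "(\<exists>v. lex_match ?N u v) \<longleftrightarrow> card (lex_ge ?N b) \<le> card (borel_set u) + k_val ?N u0 t"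
  proof
    assume "\<exists>v. lex_match ?N u v"
    then obtain x where x: "lex_match ?N u x" by blast
    then have xu: "x \<in> lex_ge ?N u" and "\<forall>i\<in>{1..m}. card (borel_set u \<inter> mons i) = card (lex_ge ?N x \<inter> mons i)"
      by (auto simp: lex_match_def)
    then have "x \<le> z" using interval by blast
    then have "z \<in> lex_ge ?N x" using xu zN zm(2) u(2) by (simp add: lex_ge_iff)
    then have "card (lex_ge ?N z) \<le> card (lex_ge ?N x)" by (intro card_mono finite_lex_ge lex_ge_antimono)
    then show "card (lex_ge ?N b) \<le> card (borel_set u) + k_val ?N u0 t"
      using card_b lex_match_card[OF x u(1)] by simp
  next
    assume "card (lex_ge ?N b) \<le> card (borel_set u) + k_val ?N u0 t"
    \<comment> \<open>The segment of the size of the Borel set is squeezed between those of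
      \<open>z\<close> and \<open>b\<close>, so \<open>v\<close> lies in the interval.\<close>
    then have "card (lex_ge ?N z) \<le> card L" using card_b L(2) by simp
    then have "lex_ge ?N z \<subseteq> L" using lexseg_subset[OF seg[OF zm(2)] L(1)] by simp
    then have "v \<le> z" using mem[OF zN] v(4) by (auto simp: lex_ge_iff)
    moreover have "L \<subseteq> lex_ge ?N b" using lexseg_subset[OF L(1) seg[OF b(2)]] L(2) card_B_le by simp
    then have "b \<le> v" using v(1) by (auto simp: lex_ge_iff)
    ultimately have i: "\<forall>i\<in>{1..m}. card (borel_set u \<inter> mons i) = card (lex_ge ?N v \<inter> mons i)"
      using interval[OF vu] by simp
    moreover have "card (borel_set u \<inter> mons ?N) = card (lex_ge ?N v \<inter> mons ?N)"
      using all[OF borel_set_subset[OF u(1)]] lex_all L(2) v(4) by simp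
    ultimately have "\<forall>i\<in>{1..?N}. card (borel_set u \<inter> mons i) = card (lex_ge ?N v \<inter> mons i)"
      by (auto simp: le_Suc_eq)
    then show "\<exists>v. lex_match ?N u v" using vu by (auto simp: lex_match_def)
  qed
qed

text \<open>From one exponent to the next, the Borel set and the segment at \<open>b\<close> grow by
  the sizes of their new parts in \<open>mons m\<close>. These are equal, so the difference
  \<open>g\<close> is constant. The last conclusion serves to bound \<open>g\<close> from
  below.\<close>

lemma step_up_series:
  assumes u0: "u0 \<in> mons m" and m: "1 \<le> m" and z: "lex_match m (u0 + xpow m s) z"
  obtains g where
    "\<And>r. f_val (Suc m) u0 (s + r) = h_val (Suc m) u0 (s + r) + g"
    "\<And>r. k_val (Suc m) u0 (s + r) = k_val (Suc m) u0 s + r"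
    "\<And>r. (\<exists>v. lex_match (Suc m) (u0 + xpow (Suc m) (s + r)) v) \<longleftrightarrow> g \<le> k_val (Suc m) u0 s + r"
    "card (borel_set (u0 + xpow (Suc m) s)) + g = card (lex_ge (Suc m) z) + k_val (Suc m) u0 s"
proof -
  let ?N = "Suc m"
  define u where "u r = u0 + xpow ?N (s + r)" for r
  define b where "b r = max (u r) (corner m (z + xpow m r))" for r
  \<comment> \<open>\<open>step_up_le\<close> makes this subtraction exact.\<close>
  define g where "g = card (lex_ge ?N (b 0)) - card (borel_set (u 0))"
  have zr: "lex_match m (u0 + xpow m (s + r)) (z + xpow m r)" for r
    using lex_match_xpow[OF _ m z, of r] u0 m by (simp add: mons_add_iff xpow_in_mons add.assoc single_add)
  note step = step_up_z[OF u0 m zr] step_up_le[OF u0 m zr] step_up_f[OF u0 m zr] step_up_iff[OF u0 m zr]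
    step_up_Int[OF u0 m zr] step_up_mons[OF u0 m zr] step_up_card[OF u0 m zr]
  note step = step[folded u_def, folded b_def]
  have uN: "u r \<in> mons ?N" for r
    using u0 mons_mono[of m ?N] by (auto simp: u_def mons_add_iff xpow_in_mons)
  have u_Suc: "u (Suc r) = u r + xvar ?N" for r using xpow_Suc[of u0 ?N "s + r"] by (simp add: u_def)
  \<comment> \<open>Both arguments of the maximum gain the factor x_{m+1}^r, and the order respects
    multiplication.\<close>
  have b_eq: "b r = b 0 + xpow ?N r" for r
    by (simp add: b_def u_def corner_add max_add_distrib_left add.assoc single_add)
  have b_Suc: "b (Suc r) = b r + xvar ?N" for r
    using xpow_Suc[of "b 0" ?N r] b_eq[of r] b_eq[of "Suc r"] by simp
  have g: "card (lex_ge ?N (b r)) = card (borel_set (u r)) + g" for r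
  proof (induction r)
    case 0
    then show ?case using step(2)[of 0] by (simp add: g_def)
  next
    case (Suc r)
    have B: "card (borel_set (u (Suc r)) \<inter> mons ?N) = card (borel_set (u (Suc r)) \<inter> mons m) + card (borel_set (u r) \<inter> mons ?N)"
      using card_mulvars_step[OF borel_set_stable borel_set_subset[OF uN], of m] mulvars_borel_set[OF uN] by (simp add: u_Suc)
    have L: "card (lex_ge ?N (b (Suc r)) \<inter> mons ?N) = card (lex_ge ?N (b (Suc r)) \<inter> mons m) + card (lex_ge ?N (b r) \<inter> mons ?N)"
      using card_mulvars_step[OF lex_ge_stable lex_ge_subset[of ?N "b r"], of m] mulvars_lex_ge[OF step(6)] by (simp add: b_Suc)
    have all: "borel_set (u r) \<inter> mons ?N = borel_set (u r)" "lex_ge ?N (b r) \<inter> mons ?N = lex_ge ?N (b r)" for r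
      using Int_mons_all[OF borel_set_subset[OF uN]] Int_mons_all[OF lex_ge_subset] by auto
    show ?case using B L step(5)[of "Suc r"] Suc unfolding all by simp
  qed
  have k: "k_val ?N u0 (s + r) = k_val ?N u0 s + r" for r
    using step(1)[of r] step(1)[of 0] b_eq[of r] by (simp add: k_val_def lookup_add)
  show thesis
  proof (rule that)
    fix r
    show "f_val ?N u0 (s + r) = h_val ?N u0 (s + r) + g" using step(3)[of r] g[of r] by simp
    show "k_val ?N u0 (s + r) = k_val ?N u0 s + r" by (rule k)
    show "(\<exists>v. lex_match ?N (u0 + xpow ?N (s + r)) v) \<longleftrightarrow> g \<le> k_val ?N u0 s + r"
      using step(4)[of r] g[of r] k[of r] by (simp add: u_def)
    show "card (borel_set (u0 + xpow ?N s)) + g = card (lex_ge ?N z) + k_val ?N u0 s"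
      using step(7)[of 0] g[of 0] by (simp add: u_def)
  qed
qed

section \<open>The threshold\<close>

text \<open>Induction on the number of variables: the part of \<open>u\<close> free of the last
  variable is eventually matched in fewer variables, and then \<open>step_up_series\<close> asks
  only for a large exponent.\<close>

lemma lex_match_exists_eventually:
  assumes "1 \<le> n"
  shows "u \<in> mons n \<Longrightarrow> \<exists>s v. lex_match n (u + xpow n s) v"
  using assms
proof (induction n arbitrary: u rule: dec_induct)
  case base
  have "borel_set u = lex_ge 1 u"
  proof
    show "borel_set u \<subseteq> lex_ge 1 u" using base by (rule borel_set_subset_lex_ge)
    show "lex_ge 1 u \<subseteq> borel_set u"
    proof
      fix y assume y: "y \<in> lex_ge 1 u"
      have "y = u"
        using y base by (intro mons_deg_eqI[of _ 1]) (auto simp: lex_ge_iff mons_iff)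
      then show "y \<in> borel_set u" by (simp add: borel_set.base)
    qed
  qed
  then have "lex_match 1 (u + xpow 1 0) u" using base by (simp add: lex_match_def lex_ge_iff)
  then show ?case by blast
next
  case (step m)
  obtain w a where w: "u = w + xpow (Suc m) a" "w \<in> mons m"
  proof -
    obtain w where w: "u = w + xpow (Suc m) (expo u (Suc m))" "expo w (Suc m) = 0"
      using expo_ge_split[of "expo u (Suc m)" u "Suc m"] by auto
    have wS: "w \<in> mons (Suc m)" using step.prems w(1) mons_add_iff by metis
    have "expo w i = 0" if "m < i" for i
      using wS w(2) that by (cases "i = Suc m") (auto simp: mons_iff)
    then have "w \<in> mons m" using wS by (auto simp: mons_iff)
    then show thesis using w(1) that by blast
  qed
  obtain s z where z: "lex_match m (w + xpow m s) z" using step.IH[OF w(2)] by blast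
  obtain g where g: "\<And>r. (\<exists>v. lex_match (Suc m) (w + xpow (Suc m) (s + r)) v) \<longleftrightarrow> g \<le> k_val (Suc m) w s + r"
    using step_up_series[OF w(2) step.hyps(1) z] by metis
  \<comment> \<open>The summand \<open>g\<close> satisfies the criterion; the summand
    \<open>a\<close> accounts for the power of x_{m+1} already in \<open>u\<close>.\<close>
  have "\<exists>v. lex_match (Suc m) (w + xpow (Suc m) (s + (g + a))) v" using g[of "g + a"] by simp
  moreover have "w + xpow (Suc m) (s + (g + a)) = u + xpow (Suc m) (s + g)"
    by (simp add: w(1) add.assoc ac_simps flip: single_add)
  ultimately show ?case by metis
qed

text \<open>Matches exist eventually and persist under multiplication by x_n, so the admissible
  exponents are all those from a minimum on, and \<open>THE\<close> picks this minimum.\<close>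

lemma gotzmann_threshold_iff:
  assumes u: "u \<in> mons n" and n: "1 \<le> n"
  shows "(\<exists>v. lex_match n (u + xpow n s) v) \<longleftrightarrow> gotzmann_threshold TYPE('k::field) n u \<le> s"
proof -
  let ?P = "\<lambda>s. \<exists>v. lex_match n (u + xpow n s) v"
  have us: "u + xpow n s \<in> mons n" for s using u n by (simp add: mons_add_iff xpow_in_mons)
  have P_add: "?P (s + r)" if "?P s" for s r
    using that lex_match_xpow[OF us n, of s] by (metis add.assoc single_add)
  have "\<exists>s. ?P s" using lex_match_exists_eventually[OF n u] .
  then have Least: "?P (LEAST s. ?P s)" by (rule LeastI_ex)
  have iff: "?P s \<longleftrightarrow> (LEAST s. ?P s) \<le> s" for s
    using P_add[OF Least, of "s - (LEAST s. ?P s)"] Least_le[of ?P s] by auto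
  have "gotzmann_threshold TYPE('k) n u = (LEAST s. ?P s)"
    unfolding gotzmann_threshold_def gotzmann_monomial_iff[OF us n]
  proof (rule the_equality)
    show "\<forall>s. ?P s \<longleftrightarrow> (LEAST s. ?P s) \<le> s" using iff by blast
    fix \<tau> assume "\<forall>s. ?P s \<longleftrightarrow> \<tau> \<le> s"
    then have "\<tau> \<le> s \<longleftrightarrow> (LEAST s. ?P s) \<le> s" for s using iff by blast
    then show "\<tau> = (LEAST s. ?P s)" by (meson antisym order_refl)
  qed
  then show ?thesis using iff[of s] by simp
qed

section \<open>Polynomiality\<close>

text \<open>Newton form of a polynomial function on the naturals, in which summation merely shifts
  coefficients.\<close>

definition binomial_sum :: "(nat \<Rightarrow> rat) \<Rightarrow> bool" where
  "binomial_sum g \<longleftrightarrow> (\<exists>a K. \<forall>t. g t = (\<Sum>k<K. a k * of_nat (t choose k)))"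

text \<open>Pascal's rule: each coefficient moves up one index, and \<open>g 0\<close> becomes the
  constant one.\<close>

lemma binomial_sum_antidifference:
  assumes "binomial_sum d" "\<And>t. g (Suc t) = g t + d t"
  shows "binomial_sum g"
proof -
  obtain a K where a: "\<And>t. d t = (\<Sum>k<K. a k * of_nat (t choose k))"
    using assms(1) by (auto simp: binomial_sum_def)
  define a' where "a' k = (case k of 0 \<Rightarrow> g 0 | Suc j \<Rightarrow> a j)" for k
  have "g t = (\<Sum>k<Suc K. a' k * of_nat (t choose k))" for t
  proof (induction t)
    case 0
    have "(\<Sum>k<K. a k * of_nat (0 choose Suc k)) = 0" by (intro sum.neutral) simp
    then show ?case by (simp add: sum.lessThan_Suc_shift a'_def del: sum.lessThan_Suc)
  next
    case (Suc t)
    have "(\<Sum>k<Suc K. a' k * of_nat (Suc t choose k)) = (\<Sum>k<Suc K. a' k * of_nat (t choose k)) + d t"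
      unfolding sum.lessThan_Suc_shift a by (simp add: a'_def algebra_simps sum.distrib)
    then show ?case using Suc assms(2) by simp
  qed
  then show ?thesis unfolding binomial_sum_def by blast
qed

lemma binomial_sum_0: "binomial_sum (\<lambda>t. 0)"
  unfolding binomial_sum_def by (intro exI[of _ "\<lambda>k. 0"] exI[of _ 0]) simp

lemma binomial_sum_extend:
  assumes "binomial_sum g"
  shows "\<exists>a K. \<forall>L\<ge>K. \<forall>t. g t = (\<Sum>k<L. a k * of_nat (t choose k))"
proof -
  obtain a K where a: "\<And>t. g t = (\<Sum>k<K. a k * of_nat (t choose k))"
    using assms by (auto simp: binomial_sum_def)
  have "g t = (\<Sum>k<L. (if k < K then a k else 0) * of_nat (t choose k))" if "K \<le> L" for L t
    unfolding a using that by (intro sum.mono_neutral_cong_left) auto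
  then show ?thesis by (intro exI[of _ "\<lambda>k. if k < K then a k else 0"] exI[of _ K]) blast
qed

lemma binomial_sum_add:
  assumes "binomial_sum g" "binomial_sum h"
  shows "binomial_sum (\<lambda>t. g t + c * h t)"
proof -
  obtain K a where a: "\<And>L t. K \<le> L \<Longrightarrow> g t = (\<Sum>k<L. a k * of_nat (t choose k))"
    using binomial_sum_extend[OF assms(1)] by blast
  obtain K' a' where a': "\<And>L t. K' \<le> L \<Longrightarrow> h t = (\<Sum>k<L. a' k * of_nat (t choose k))"
    using binomial_sum_extend[OF assms(2)] by blast
  have "g t + c * h t = (\<Sum>k<max K K'. (a k + c * a' k) * of_nat (t choose k))" for t
    unfolding a[OF max.cobounded1[of K K']] a'[OF max.cobounded2[of K' K]]
    by (simp add: algebra_simps sum.distrib sum_distrib_left)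
  then show ?thesis
    unfolding binomial_sum_def by (intro exI[of _ "\<lambda>k. a k + c * a' k"] exI[of _ "max K K'"]) blast
qed

lemma binomial_sum_poly:
  assumes "binomial_sum g"
  obtains p :: "rat poly" where "\<And>t. poly p (of_nat t) = g t"
proof -
  obtain a K where a: "\<And>t. g t = (\<Sum>k<K. a k * of_nat (t choose k))"
    using assms by (auto simp: binomial_sum_def)
  have "poly (\<Sum>k<K. smult (a k / fact k) (\<Prod>i = 0..<k. [:- of_nat i, 1:])) (of_nat t) = g t" for t
    unfolding a poly_sum
    by (intro sum.cong refl) (simp add: poly_prod binomial_gbinomial gbinomial_prod_rev)
  then show thesis using that by blast
qed

section \<open>Gap counts as polynomial functions\<close>

lemma gaps_Suc:
  assumes u: "u \<in> mons n" and i: "Suc i \<le> n"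
  shows "card (gaps n (u + xvar n) \<inter> mons (Suc i)) =
    card (gaps n (u + xvar n) \<inter> mons i) + card (gaps n u \<inter> mons (Suc i))"
proof -
  have n: "1 \<le> n" using i by simp
  have un: "u + xvar n \<in> mons n" using u n by (simp add: mons_add_iff xvar_in_mons_iff)
  have "card (borel_set (u + xvar n) \<inter> mons (Suc i)) = card (borel_set (u + xvar n) \<inter> mons i) + card (borel_set u \<inter> mons (Suc i))"
    using card_mulvars_step[OF borel_set_stable borel_set_subset[OF u] i] mulvars_borel_set[OF u n] by simp
  moreover have "card (lex_ge n (u + xvar n) \<inter> mons (Suc i)) = card (lex_ge n (u + xvar n) \<inter> mons i) + card (lex_ge n u \<inter> mons (Suc i))"
    using card_mulvars_step[OF lex_ge_stable lex_ge_subset[of n u] i] mulvars_lex_ge[OF u n] by simp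
  ultimately show ?thesis
    using card_gaps[OF un, of "mons i"] card_gaps[OF un, of "mons (Suc i)"] card_gaps[OF u, of "mons (Suc i)"] by linarith
qed

text \<open>The difference at \<open>t\<close> of the count in \<open>mons (Suc i)\<close> is the
  count in \<open>mons i\<close> at \<open>t + 1\<close>, so the shifted function is carried through
  the induction.\<close>

lemma binomial_sum_gaps:
  assumes u: "u \<in> mons n" and n: "1 \<le> n"
  shows "i \<le> n \<Longrightarrow> binomial_sum (\<lambda>t. of_nat (card (gaps n (u + xpow n t) \<inter> mons i))) \<and>
    binomial_sum (\<lambda>t. of_nat (card (gaps n (u + xpow n (Suc t)) \<inter> mons i)))"
proof (induction i)
  case 0
  have "card (gaps n v \<inter> mons 0) = 0" for v using zero_notin_gaps by (simp add: mons_0_eq)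
  then show ?case using binomial_sum_0 by simp
next
  case (Suc i)
  let ?D = "\<lambda>t. of_nat (card (gaps n (u + xpow n t) \<inter> mons (Suc i))) :: rat"
  have us: "u + xpow n s \<in> mons n" for s using u n by (simp add: mons_add_iff xpow_in_mons)
  have D: "?D (Suc t) = ?D t + of_nat (card (gaps n (u + xpow n (Suc t)) \<inter> mons i))" for t
    unfolding xpow_Suc gaps_Suc[OF us Suc.prems] by simp
  have 1: "binomial_sum ?D" by (rule binomial_sum_antidifference[where g = ?D, OF _ D]) (use Suc in simp)
  moreover have "binomial_sum (\<lambda>t. ?D (Suc t))"
    using binomial_sum_add[OF 1, of _ 1] Suc unfolding D by simp
  ultimately show ?case by blast
qed

lemma f_val_poly:
  assumes u: "u \<in> mons (Suc m)"
  obtains p :: "rat poly" where "\<And>t. poly p (of_nat t) = of_nat (f_val (Suc m) u t)"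
proof -
  let ?D = "\<lambda>i t. of_nat (card (gaps (Suc m) (u + xpow (Suc m) t) \<inter> mons i)) :: rat"
  have "binomial_sum (\<lambda>t. ?D (Suc m) t + (- 1) * ?D m t)"
    using binomial_sum_gaps[OF u, of "Suc m"] binomial_sum_gaps[OF u, of m] by (intro binomial_sum_add) auto
  moreover have "?D (Suc m) t + (- 1) * ?D m t = of_nat (f_val (Suc m) u t)" for t
    using expo_maxgen[OF gaps_subset zero_notin_gaps, of "Suc m" "u + xpow (Suc m) t" m, symmetric]
    by (simp add: f_val_def mg_def)
  ultimately show thesis using that binomial_sum_poly by (metis (no_types, lifting))
qed

section \<open>The threshold from the polynomials at zero\<close>

theorem theorem4p15:
  fixes n :: nat and u0 :: mon
  assumes "n \<ge> 3" and "u0 \<in> mons (n - 1)"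
  shows "rat_of_nat (gotzmann_threshold TYPE('k::field) n u0) =
           poly (f_poly n u0) 0 - poly (h_poly TYPE('k) n u0) 0 - poly (k_poly TYPE('k) n u0) 0"
proof -
  define m where "m = n - 1"
  have n: "n = Suc m" and m: "1 \<le> m" and u0: "u0 \<in> mons m" using assms by (auto simp: m_def)
  have u0N: "u0 \<in> mons (Suc m)" using u0 mons_mono[of m "Suc m"] by auto
  define s where "s = gotzmann_threshold TYPE('k) m u0"
  have s_iff: "(\<exists>v. lex_match m (u0 + xpow m t) v) \<longleftrightarrow> s \<le> t" for t
    unfolding s_def by (rule gotzmann_threshold_iff[OF u0 m])
  obtain z where z: "lex_match m (u0 + xpow m s) z" using s_iff[of s] by blast
  obtain g where
    f: "\<And>r. f_val (Suc m) u0 (s + r) = h_val (Suc m) u0 (s + r) + g" and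
    k: "\<And>r. k_val (Suc m) u0 (s + r) = k_val (Suc m) u0 s + r" and
    iff: "\<And>r. (\<exists>v. lex_match (Suc m) (u0 + xpow (Suc m) (s + r)) v) \<longleftrightarrow> g \<le> k_val (Suc m) u0 s + r" and
    g: "card (borel_set (u0 + xpow (Suc m) s)) + g = card (lex_ge (Suc m) z) + k_val (Suc m) u0 s"
    using step_up_series[OF u0 m z] by metis
  let ?k = "k_val (Suc m) u0 s"
  \<comment> \<open>This makes \<open>g - ?k\<close> exact, as the formula over the rationals
    requires.\<close>
  have g_ge: "?k \<le> g"
  proof (cases "s = 0")
    case True
    have um: "u0 + xpow m 0 \<in> mons m" using u0 by simp
    \<comment> \<open>At exponent zero both rings have the same Borel set, so its size can be
      compared with the segments of \<open>z\<close> in both.\<close>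
    have "card (borel_set u0) = card (lex_ge m z)"
      using lex_match_card[OF z[unfolded True] um m] by simp
    also have "\<dots> \<le> card (lex_ge (Suc m) z)"
      using mons_mono[of m "Suc m"] by (intro card_mono finite_lex_ge) (auto simp: lex_ge_iff)
    finally show ?thesis using g True by simp
  next
    case False
    then obtain r where r: "s = Suc r" by (cases s) auto
    have ur: "u0 + xpow m r \<in> mons m" using u0 m by (simp add: mons_add_iff xpow_in_mons)
    \<comment> \<open>A factor x_m of \<open>z\<close> could be cancelled, giving a match at
      exponent \<open>r\<close>, below the minimum \<open>s\<close>.\<close>
    have "expo z m = 0"
    proof (rule ccontr)
      assume "expo z m \<noteq> 0"
      then obtain w where "z = w + xvar m" using expo_pos_split[of z m] by auto
      then have "lex_match m (u0 + xpow m r) w"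
        using z lex_match_mulvars[OF ur m] by (simp add: r xpow_Suc)
      then show False using s_iff[of r] r by auto
    qed
    then have "corner m z = z" by (simp add: corner_def)
    moreover have zm: "z \<in> mons m" "u0 + xpow m s \<le> z" using z by (auto simp: lex_match_def lex_ge_iff)
    moreover have "u0 + xpow (Suc m) s \<le> u0 + xpow m s"
      by (intro add_left_mono xpow_mono) simp
    then have "u0 + xpow (Suc m) s \<le> z" using zm(2) by (rule order_trans)
    ultimately have "z_mon (Suc m) u0 s = z" using step_up_z[OF u0 m z] by (simp add: max_def)
    then have "?k = 0" using zm by (simp add: k_val_def mons_iff)
    then show ?thesis by simp
  qed
  have tau: "gotzmann_threshold TYPE('k) (Suc m) u0 = s + (g - ?k)"
  proof -
    have "gotzmann_threshold TYPE('k) (Suc m) u0 \<le> t \<longleftrightarrow> s + (g - ?k) \<le> t" for t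
    proof (cases "s \<le> t")
      case True
      then show ?thesis
        using gotzmann_threshold_iff[OF u0N, of t, where 'k = 'k] iff[of "t - s"] by auto
    next
      case False
      then have "\<not> (\<exists>v. lex_match (Suc m) (u0 + xpow (Suc m) t) v)"
        using lex_match_down[OF u0 m] s_iff by blast
      then show ?thesis using gotzmann_threshold_iff[OF u0N, of t, where 'k = 'k] False by auto
    qed
    then show ?thesis by (meson antisym order_refl)
  qed
  obtain p :: "rat poly" where p: "\<And>t. poly p (of_nat t) = of_nat (f_val (Suc m) u0 t)"
    using f_val_poly[OF u0N] by blast
  have "f_poly n u0 = p" unfolding f_poly_def n by (rule poly_from_eqI) (rule p)
  moreover have "h_poly TYPE('k) n u0 = p - [:of_nat g:]"
    unfolding h_poly_def n diff_Suc_1 s_def[symmetric]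
  proof (rule poly_from_eqI)
    fix t assume "s \<le> t"
    then show "poly (p - [:of_nat g:]) (of_nat t) = of_nat (h_val (Suc m) u0 t)"
      using p[of t] f[of "t - s"] by simp
  qed
  \<comment> \<open>Slope one and value \<open>?k\<close> at \<open>s\<close>; the constant
    coefficient may be negative, so it is formed in the rationals.\<close>
  moreover have "k_poly TYPE('k) n u0 = [:of_nat ?k - of_nat s, 1:]"
    unfolding k_poly_def n diff_Suc_1 s_def[symmetric]
  proof (rule poly_from_eqI)
    fix t assume "s \<le> t"
    then show "poly [:of_nat ?k - of_nat s, 1:] (of_nat t) = (of_nat (k_val (Suc m) u0 t) :: rat)"
      using k[of "t - s"] by (simp add: of_nat_diff)
  qed
  \<comment> \<open>At zero, f minus h is \<open>g\<close> and k is \<open>?k - s\<close>, which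
    leaves \<open>s + (g - ?k)\<close>.\<close>
  ultimately show ?thesis using tau g_ge by (simp add: n of_nat_diff)
qed

end
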